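(* The curvature tensor $\rho_k{}^n{}_{ij}$ of the two-dimensional Finsler space $(M,F)$ equipped with the angle-preserving connection $\{N^k_n,D^k{}_{nm}\}$ is such that the tensor $\rho_{knij}=g_{nm}\,\rho_k{}^m{}_{ij}=\rho_{knij}(x,y)$ is proportional to the tensor $\bar L_{knij}=a_{nh}\bar L_k{}^h{}_{ij}=\bar L_{knij}(x)$, which does not involve any dependence on tangent vectors. The factor of proportionality is expressed through the determinants of the metric tensors: $$\rho_{knij}(x,y)=f_1\,\bar L_{knij}(x),\qquad f_1=\sqrt{\frac{\det(g_{hl}(x,y))}{\det(a_{mn}(x))}} .$$
   Context: Finsler setting. $M$ is a 2-dimensional $C^\infty$ manifold; the consideration is local, in coordinates $x^1,x^2$ with induced fibre coordinates $y^1,y^2$ (no orientation-reversing changes). $F=F(x,y)$ is a Finsler metric function (positive, positively homogeneous of degree 1 in $y$, sufficiently smooth for $y\ne0$, with positive definite metric tensor). Notation: $l^k=y^k/F$, $y_k=F\,\partial F/\partial y^k$, $l_k=y_k/F$, $g_{ij}=\partial y_i/\partial y^j$, $g^{ij}$ its inverse, $C_{ijk}=\frac12\partial g_{ij}/\partial y^k$, $C^n{}_{hk}=g^{nj}C_{jhk}$. With $\gamma_{11}=\gamma_{22}=0$, $\gamma_{12}=-\gamma_{21}=1$, put $\epsilon_{ik}=\sqrt{\det(g_{mn})}\,\gamma_{ik}$, $m_i=-\epsilon_{ik}l^k$, $m^i=g^{ij}m_j$; then $g_{ij}=l_il_j+m_im_j$. A nowhere vanishing contravariant vector field $b^i(x)$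 on $M$ is fixed, and the angle function $\theta=\theta(x,y)$ is the (smooth) function, positively homogeneous of degree zero in $y$, with $F\,\partial\theta/\partial y^n=m_n$ and $\theta(x,b(x))=0$ (on a conic region containing $b(x)$). Angle-preserving connection. Let $k_n(x)$ be a (smooth) covariant vector field. Put $N^k_n=-l^k\,\partial F/\partial x^n-F\,m^k(\partial\theta/\partial x^n-k_n)$, $D^k{}_{nm}=-\partial N^k_n/\partial y^m$, $d_n=\partial/\partial x^n+N^k_n\,\partial/\partial y^k$, $M^n{}_{ij}=d_iN^n_j-d_jN^n_i$, $E_k{}^n{}_{ij}=d_iD^n{}_{jk}-d_jD^n{}_{ik}+D^m{}_{jk}D^n{}_{im}-D^m{}_{ik}D^n{}_{jm}$. The curvature tensor is $\rho_k{}^n{}_{ij}=E_k{}^n{}_{ij}-M^h{}_{ij}C^n{}_{hk}$. $\theta$-associated Riemannian space. Put $a_{mn}(x)=g_{mn}(x,b(x))$ (osculating Riemannian metric), $a^{mn}$ its inverse, $\tilde b^i=b^i/\sqrt{a_{mn}b^mb^n}$, $\tilde b_i=a_{ij}\tilde b^j$, $n_i(x)=\frac{\partial\theta}{\partial y^i}(x,\tilde b(x))$, $n^i=a^{ij}n_j$; the pair $\{\tilde b_i,n_i\}$ is orthonormal with respect to $a_{ij}$. Let $a^k{}_{nh}$ be the Christoffel symbols of $a_{mn}$, $\nabla_n$ the corresponding Riemannian covariant derivative, $\epsilon^{\rm Riem}_{jh}=\sqrt{\det(a_{mn})}\,\gamma_{jh}$, $T_n=n^h\nabla_n\tilde b_h+k_n$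 (the same $k_n$), and $$\bar L^k{}_{nh}=a^{kj}\epsilon^{\rm Riem}_{jh}T_n+a^k{}_{nh},\qquad \bar L_k{}^n{}_{ij}=\frac{\partial\bar L^n{}_{jk}}{\partial x^i}-\frac{\partial\bar L^n{}_{ik}}{\partial x^j}+\bar L^m{}_{jk}\bar L^n{}_{im}-\bar L^m{}_{ik}\bar L^n{}_{jm}.$$ Repeated indices (running over $1,2$) are summed. *)

theory Defs
  imports "HOL-Analysis.Analysis"
begin

text \<open>
  Everything is done in one chart: a point has coordinates \<open>x :: real^2\<close>, a tangent vector has
  induced coordinates \<open>y :: real^2\<close>. Tensor indices are elements of the type \<open>2\<close>, whose two
  elements are \<open>1\<close> and \<open>2\<close> (the latter being the same element as \<open>0\<close>).
  Index arguments come in the order in which the indices are written, and before the point: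
  \<open>curv_E F \<theta> \<kappa> k n i j x y\<close> stands for \<open>E\<^sub>k\<^sup>n\<^sub>i\<^sub>j(x, y)\<close>.
\<close>

text \<open>Real functions of class \<open>C\<^sup>r\<close>; meant for open \<open>S\<close>.\<close>

primrec C_k_on :: "nat \<Rightarrow> 'a::euclidean_space set \<Rightarrow> ('a \<Rightarrow> real) \<Rightarrow> bool" where
  "C_k_on 0 S f \<longleftrightarrow> continuous_on S f"
| "C_k_on (Suc r) S f \<longleftrightarrow>
     (\<forall>z\<in>S. f differentiable (at z)) \<and>
     (\<forall>v. C_k_on r S (\<lambda>z. frechet_derivative f (at z) v))"

text \<open>Partial derivatives of a function of \<open>x\<close>, and of a function of \<open>(x, y)\<close> with respect to
  \<open>x\<^sup>n\<close> and \<open>y\<^sup>n\<close>.\<close>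

definition pd :: "2 \<Rightarrow> (real^2 \<Rightarrow> real) \<Rightarrow> real^2 \<Rightarrow> real" where
  "pd n f x = frechet_derivative f (at x) (axis n 1)"

definition pdx :: "2 \<Rightarrow> (real^2 \<Rightarrow> real^2 \<Rightarrow> real) \<Rightarrow> real^2 \<Rightarrow> real^2 \<Rightarrow> real" where
  "pdx n f x y = pd n (\<lambda>x'. f x' y) x"

definition pdy :: "2 \<Rightarrow> (real^2 \<Rightarrow> real^2 \<Rightarrow> real) \<Rightarrow> real^2 \<Rightarrow> real^2 \<Rightarrow> real" where
  "pdy n f x y = pd n (\<lambda>y'. f x y') y"

definition perm_symb :: "2 \<Rightarrow> 2 \<Rightarrow> real" where
  "perm_symb i k = (if i = 1 \<and> k = 2 then 1 else if i = 2 \<and> k = 1 then -1 else 0)"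


section \<open>The Finsler space\<close>

definition l_con :: "(real^2 \<Rightarrow> real^2 \<Rightarrow> real) \<Rightarrow> 2 \<Rightarrow> real^2 \<Rightarrow> real^2 \<Rightarrow> real" where
  "l_con F k x y = y $ k / F x y"

definition y_cov :: "(real^2 \<Rightarrow> real^2 \<Rightarrow> real) \<Rightarrow> 2 \<Rightarrow> real^2 \<Rightarrow> real^2 \<Rightarrow> real" where
  "y_cov F k x y = F x y * pdy k F x y"

definition g_mat :: "(real^2 \<Rightarrow> real^2 \<Rightarrow> real) \<Rightarrow> real^2 \<Rightarrow> real^2 \<Rightarrow> real^2^2" where
  "g_mat F x y = (\<chi> i j. pdy j (y_cov F i) x y)"

definition g_cov :: "(real^2 \<Rightarrow> real^2 \<Rightarrow> real) \<Rightarrow> 2 \<Rightarrow> 2 \<Rightarrow> real^2 \<Rightarrow> real^2 \<Rightarrow> real" where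
  "g_cov F i j x y = g_mat F x y $ i $ j"

definition g_con :: "(real^2 \<Rightarrow> real^2 \<Rightarrow> real) \<Rightarrow> 2 \<Rightarrow> 2 \<Rightarrow> real^2 \<Rightarrow> real^2 \<Rightarrow> real" where
  "g_con F i j x y = matrix_inv (g_mat F x y) $ i $ j"

text \<open>The smoothness required of \<open>F\<close> off the zero section is \<open>C\<^sup>5\<close>. Values on the zero section
  are irrelevant.\<close>

definition finsler_metric :: "(real^2) set \<Rightarrow> (real^2 \<Rightarrow> real^2 \<Rightarrow> real) \<Rightarrow> bool" where
  "finsler_metric U F \<longleftrightarrow>
     C_k_on 5 (U \<times> (UNIV - {0})) (\<lambda>(x, y). F x y) \<and>
     (\<forall>x\<in>U. \<forall>y. y \<noteq> 0 \<longrightarrow> F x y > 0) \<and>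
     (\<forall>x\<in>U. \<forall>y. \<forall>t>0. y \<noteq> 0 \<longrightarrow> F x (t *\<^sub>R y) = t * F x y) \<and>
     (\<forall>x\<in>U. \<forall>y. y \<noteq> 0 \<longrightarrow>
        (\<forall>v::real^2. v \<noteq> 0 \<longrightarrow> (\<Sum>i\<in>UNIV. \<Sum>j\<in>UNIV. g_cov F i j x y * v $ i * v $ j) > 0))"

definition C_cov :: "(real^2 \<Rightarrow> real^2 \<Rightarrow> real) \<Rightarrow> 2 \<Rightarrow> 2 \<Rightarrow> 2 \<Rightarrow> real^2 \<Rightarrow> real^2 \<Rightarrow> real" where
  "C_cov F i j k x y = 1 / 2 * pdy k (g_cov F i j) x y"

definition C_mix :: "(real^2 \<Rightarrow> real^2 \<Rightarrow> real) \<Rightarrow> 2 \<Rightarrow> 2 \<Rightarrow> 2 \<Rightarrow> real^2 \<Rightarrow> real^2 \<Rightarrow> real" where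
  "C_mix F n h k x y = (\<Sum>j\<in>UNIV. g_con F n j x y * C_cov F j h k x y)"

definition eps :: "(real^2 \<Rightarrow> real^2 \<Rightarrow> real) \<Rightarrow> 2 \<Rightarrow> 2 \<Rightarrow> real^2 \<Rightarrow> real^2 \<Rightarrow> real" where
  "eps F i k x y = sqrt (det (g_mat F x y)) * perm_symb i k"

definition m_cov :: "(real^2 \<Rightarrow> real^2 \<Rightarrow> real) \<Rightarrow> 2 \<Rightarrow> real^2 \<Rightarrow> real^2 \<Rightarrow> real" where
  "m_cov F i x y = - (\<Sum>k\<in>UNIV. eps F i k x y * l_con F k x y)"

definition m_con :: "(real^2 \<Rightarrow> real^2 \<Rightarrow> real) \<Rightarrow> 2 \<Rightarrow> real^2 \<Rightarrow> real^2 \<Rightarrow> real" where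
  "m_con F i x y = (\<Sum>j\<in>UNIV. g_con F i j x y * m_cov F j x y)"

text \<open>\<open>\<Omega>\<close> is an open part of the slit tangent bundle over \<open>U\<close> whose fibre over each \<open>x\<close> is a
  connected cone containing \<open>b x\<close>.\<close>

definition conic_region ::
  "(real^2) set \<Rightarrow> (real^2 \<Rightarrow> real^2) \<Rightarrow> ((real^2) \<times> (real^2)) set \<Rightarrow> bool" where
  "conic_region U b \<Omega> \<longleftrightarrow>
     open \<Omega> \<and> \<Omega> \<subseteq> U \<times> (UNIV - {0}) \<and>
     (\<forall>x\<in>U. (x, b x) \<in> \<Omega>) \<and>
     (\<forall>x y. \<forall>t>0. (x, y) \<in> \<Omega> \<longrightarrow> (x, t *\<^sub>R y) \<in> \<Omega>) \<and>
     (\<forall>x\<in>U. connected {y. (x, y) \<in> \<Omega>})"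

definition angle_function ::
  "(real^2) set \<Rightarrow> ((real^2) \<times> (real^2)) set \<Rightarrow> (real^2 \<Rightarrow> real^2 \<Rightarrow> real) \<Rightarrow> (real^2 \<Rightarrow> real^2) \<Rightarrow>
   (real^2 \<Rightarrow> real^2 \<Rightarrow> real) \<Rightarrow> bool" where
  "angle_function U \<Omega> F b \<theta> \<longleftrightarrow>
     C_k_on 3 \<Omega> (\<lambda>(x, y). \<theta> x y) \<and>
     (\<forall>(x, y)\<in>\<Omega>. \<forall>t>0. \<theta> x (t *\<^sub>R y) = \<theta> x y) \<and>
     (\<forall>(x, y)\<in>\<Omega>. \<forall>n. F x y * pdy n \<theta> x y = m_cov F n x y) \<and>
     (\<forall>x\<in>U. \<theta> x (b x) = 0)"


section \<open>The angle-preserving connection\<close>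

definition N_coef ::
  "(real^2 \<Rightarrow> real^2 \<Rightarrow> real) \<Rightarrow> (real^2 \<Rightarrow> real^2 \<Rightarrow> real) \<Rightarrow> (real^2 \<Rightarrow> real^2) \<Rightarrow>
   2 \<Rightarrow> 2 \<Rightarrow> real^2 \<Rightarrow> real^2 \<Rightarrow> real" where
  "N_coef F \<theta> \<kappa> k n x y =
     - l_con F k x y * pdx n F x y - F x y * m_con F k x y * (pdx n \<theta> x y - \<kappa> x $ n)"

definition D_coef ::
  "(real^2 \<Rightarrow> real^2 \<Rightarrow> real) \<Rightarrow> (real^2 \<Rightarrow> real^2 \<Rightarrow> real) \<Rightarrow> (real^2 \<Rightarrow> real^2) \<Rightarrow>
   2 \<Rightarrow> 2 \<Rightarrow> 2 \<Rightarrow> real^2 \<Rightarrow> real^2 \<Rightarrow> real" where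
  "D_coef F \<theta> \<kappa> k n m x y = - pdy m (N_coef F \<theta> \<kappa> k n) x y"

definition d_op ::
  "(real^2 \<Rightarrow> real^2 \<Rightarrow> real) \<Rightarrow> (real^2 \<Rightarrow> real^2 \<Rightarrow> real) \<Rightarrow> (real^2 \<Rightarrow> real^2) \<Rightarrow>
   2 \<Rightarrow> (real^2 \<Rightarrow> real^2 \<Rightarrow> real) \<Rightarrow> real^2 \<Rightarrow> real^2 \<Rightarrow> real" where
  "d_op F \<theta> \<kappa> n f x y = pdx n f x y + (\<Sum>k\<in>UNIV. N_coef F \<theta> \<kappa> k n x y * pdy k f x y)"

definition curv_M ::
  "(real^2 \<Rightarrow> real^2 \<Rightarrow> real) \<Rightarrow> (real^2 \<Rightarrow> real^2 \<Rightarrow> real) \<Rightarrow> (real^2 \<Rightarrow> real^2) \<Rightarrow>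
   2 \<Rightarrow> 2 \<Rightarrow> 2 \<Rightarrow> real^2 \<Rightarrow> real^2 \<Rightarrow> real" where
  "curv_M F \<theta> \<kappa> n i j x y =
     d_op F \<theta> \<kappa> i (N_coef F \<theta> \<kappa> n j) x y - d_op F \<theta> \<kappa> j (N_coef F \<theta> \<kappa> n i) x y"

definition curv_E ::
  "(real^2 \<Rightarrow> real^2 \<Rightarrow> real) \<Rightarrow> (real^2 \<Rightarrow> real^2 \<Rightarrow> real) \<Rightarrow> (real^2 \<Rightarrow> real^2) \<Rightarrow>
   2 \<Rightarrow> 2 \<Rightarrow> 2 \<Rightarrow> 2 \<Rightarrow> real^2 \<Rightarrow> real^2 \<Rightarrow> real" where
  "curv_E F \<theta> \<kappa> k n i j x y =
     d_op F \<theta> \<kappa> i (D_coef F \<theta> \<kappa> n j k) x y - d_op F \<theta> \<kappa> j (D_coef F \<theta> \<kappa> n i k) x y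
     + (\<Sum>m\<in>UNIV. D_coef F \<theta> \<kappa> m j k x y * D_coef F \<theta> \<kappa> n i m x y)
     - (\<Sum>m\<in>UNIV. D_coef F \<theta> \<kappa> m i k x y * D_coef F \<theta> \<kappa> n j m x y)"

definition rho_mix ::
  "(real^2 \<Rightarrow> real^2 \<Rightarrow> real) \<Rightarrow> (real^2 \<Rightarrow> real^2 \<Rightarrow> real) \<Rightarrow> (real^2 \<Rightarrow> real^2) \<Rightarrow>
   2 \<Rightarrow> 2 \<Rightarrow> 2 \<Rightarrow> 2 \<Rightarrow> real^2 \<Rightarrow> real^2 \<Rightarrow> real" where
  "rho_mix F \<theta> \<kappa> k n i j x y =
     curv_E F \<theta> \<kappa> k n i j x y - (\<Sum>h\<in>UNIV. curv_M F \<theta> \<kappa> h i j x y * C_mix F n h k x y)"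

definition rho_cov ::
  "(real^2 \<Rightarrow> real^2 \<Rightarrow> real) \<Rightarrow> (real^2 \<Rightarrow> real^2 \<Rightarrow> real) \<Rightarrow> (real^2 \<Rightarrow> real^2) \<Rightarrow>
   2 \<Rightarrow> 2 \<Rightarrow> 2 \<Rightarrow> 2 \<Rightarrow> real^2 \<Rightarrow> real^2 \<Rightarrow> real" where
  "rho_cov F \<theta> \<kappa> k n i j x y = (\<Sum>m\<in>UNIV. g_cov F n m x y * rho_mix F \<theta> \<kappa> k m i j x y)"


section \<open>The associated Riemannian space\<close>

definition a_mat :: "(real^2 \<Rightarrow> real^2 \<Rightarrow> real) \<Rightarrow> (real^2 \<Rightarrow> real^2) \<Rightarrow> real^2 \<Rightarrow> real^2^2" where
  "a_mat F b x = g_mat F x (b x)"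

definition a_cov ::
  "(real^2 \<Rightarrow> real^2 \<Rightarrow> real) \<Rightarrow> (real^2 \<Rightarrow> real^2) \<Rightarrow> 2 \<Rightarrow> 2 \<Rightarrow> real^2 \<Rightarrow> real" where
  "a_cov F b m n x = a_mat F b x $ m $ n"

definition a_con ::
  "(real^2 \<Rightarrow> real^2 \<Rightarrow> real) \<Rightarrow> (real^2 \<Rightarrow> real^2) \<Rightarrow> 2 \<Rightarrow> 2 \<Rightarrow> real^2 \<Rightarrow> real" where
  "a_con F b m n x = matrix_inv (a_mat F b x) $ m $ n"

definition bt :: "(real^2 \<Rightarrow> real^2 \<Rightarrow> real) \<Rightarrow> (real^2 \<Rightarrow> real^2) \<Rightarrow> real^2 \<Rightarrow> real^2" where
  "bt F b x =
     (1 / sqrt (\<Sum>m\<in>UNIV. \<Sum>n\<in>UNIV. a_cov F b m n x * b x $ m * b x $ n)) *\<^sub>R b x"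

definition bt_cov ::
  "(real^2 \<Rightarrow> real^2 \<Rightarrow> real) \<Rightarrow> (real^2 \<Rightarrow> real^2) \<Rightarrow> 2 \<Rightarrow> real^2 \<Rightarrow> real" where
  "bt_cov F b i x = (\<Sum>j\<in>UNIV. a_cov F b i j x * bt F b x $ j)"

definition n_cov ::
  "(real^2 \<Rightarrow> real^2 \<Rightarrow> real) \<Rightarrow> (real^2 \<Rightarrow> real^2) \<Rightarrow> (real^2 \<Rightarrow> real^2 \<Rightarrow> real) \<Rightarrow>
   2 \<Rightarrow> real^2 \<Rightarrow> real" where
  "n_cov F b \<theta> i x = pdy i \<theta> x (bt F b x)"

definition n_con ::
  "(real^2 \<Rightarrow> real^2 \<Rightarrow> real) \<Rightarrow> (real^2 \<Rightarrow> real^2) \<Rightarrow> (real^2 \<Rightarrow> real^2 \<Rightarrow> real) \<Rightarrow>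
   2 \<Rightarrow> real^2 \<Rightarrow> real" where
  "n_con F b \<theta> i x = (\<Sum>j\<in>UNIV. a_con F b i j x * n_cov F b \<theta> j x)"

definition christoffel ::
  "(real^2 \<Rightarrow> real^2 \<Rightarrow> real) \<Rightarrow> (real^2 \<Rightarrow> real^2) \<Rightarrow> 2 \<Rightarrow> 2 \<Rightarrow> 2 \<Rightarrow> real^2 \<Rightarrow> real" where
  "christoffel F b k n h x =
     1 / 2 * (\<Sum>j\<in>UNIV. a_con F b k j x *
       (pd n (a_cov F b j h) x + pd h (a_cov F b j n) x - pd j (a_cov F b n h) x))"

text \<open>Covariant derivative \<open>\<nabla>\<^sub>n V\<^sub>h\<close> of a covector field \<open>V\<close>.\<close>

definition nabla_cov ::
  "(real^2 \<Rightarrow> real^2 \<Rightarrow> real) \<Rightarrow> (real^2 \<Rightarrow> real^2) \<Rightarrow> 2 \<Rightarrow> (2 \<Rightarrow> real^2 \<Rightarrow> real) \<Rightarrow> 2 \<Rightarrow>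
   real^2 \<Rightarrow> real" where
  "nabla_cov F b n V h x = pd n (V h) x - (\<Sum>k\<in>UNIV. christoffel F b k n h x * V k x)"

definition eps_riem ::
  "(real^2 \<Rightarrow> real^2 \<Rightarrow> real) \<Rightarrow> (real^2 \<Rightarrow> real^2) \<Rightarrow> 2 \<Rightarrow> 2 \<Rightarrow> real^2 \<Rightarrow> real" where
  "eps_riem F b j h x = sqrt (det (a_mat F b x)) * perm_symb j h"

definition T_cov ::
  "(real^2 \<Rightarrow> real^2 \<Rightarrow> real) \<Rightarrow> (real^2 \<Rightarrow> real^2) \<Rightarrow> (real^2 \<Rightarrow> real^2 \<Rightarrow> real) \<Rightarrow>
   (real^2 \<Rightarrow> real^2) \<Rightarrow> 2 \<Rightarrow> real^2 \<Rightarrow> real" where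
  "T_cov F b \<theta> \<kappa> n x =
     (\<Sum>h\<in>UNIV. n_con F b \<theta> h x * nabla_cov F b n (bt_cov F b) h x) + \<kappa> x $ n"

definition L_coef ::
  "(real^2 \<Rightarrow> real^2 \<Rightarrow> real) \<Rightarrow> (real^2 \<Rightarrow> real^2) \<Rightarrow> (real^2 \<Rightarrow> real^2 \<Rightarrow> real) \<Rightarrow>
   (real^2 \<Rightarrow> real^2) \<Rightarrow> 2 \<Rightarrow> 2 \<Rightarrow> 2 \<Rightarrow> real^2 \<Rightarrow> real" where
  "L_coef F b \<theta> \<kappa> k n h x =
     (\<Sum>j\<in>UNIV. a_con F b k j x * eps_riem F b j h x * T_cov F b \<theta> \<kappa> n x)
     + christoffel F b k n h x"

definition curv_L_mix ::
  "(real^2 \<Rightarrow> real^2 \<Rightarrow> real) \<Rightarrow> (real^2 \<Rightarrow> real^2) \<Rightarrow> (real^2 \<Rightarrow> real^2 \<Rightarrow> real) \<Rightarrow>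
   (real^2 \<Rightarrow> real^2) \<Rightarrow> 2 \<Rightarrow> 2 \<Rightarrow> 2 \<Rightarrow> 2 \<Rightarrow> real^2 \<Rightarrow> real" where
  "curv_L_mix F b \<theta> \<kappa> k n i j x =
     pd i (L_coef F b \<theta> \<kappa> n j k) x - pd j (L_coef F b \<theta> \<kappa> n i k) x
     + (\<Sum>m\<in>UNIV. L_coef F b \<theta> \<kappa> m j k x * L_coef F b \<theta> \<kappa> n i m x)
     - (\<Sum>m\<in>UNIV. L_coef F b \<theta> \<kappa> m i k x * L_coef F b \<theta> \<kappa> n j m x)"

definition curv_L_cov ::
  "(real^2 \<Rightarrow> real^2 \<Rightarrow> real) \<Rightarrow> (real^2 \<Rightarrow> real^2) \<Rightarrow> (real^2 \<Rightarrow> real^2 \<Rightarrow> real) \<Rightarrow>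
   (real^2 \<Rightarrow> real^2) \<Rightarrow> 2 \<Rightarrow> 2 \<Rightarrow> 2 \<Rightarrow> 2 \<Rightarrow> real^2 \<Rightarrow> real" where
  "curv_L_cov F b \<theta> \<kappa> k n i j x =
     (\<Sum>h\<in>UNIV. a_cov F b n h x * curv_L_mix F b \<theta> \<kappa> k h i j x)"

end

theory Submission
  imports Defs
begin

text \<open>
  Both curvature tensors are the exterior derivative \<open>d\<kappa>\<close> of the covector field \<open>\<kappa>\<close> multiplied
  by an area form, \<open>\<rho>\<^sub>k\<^sub>n\<^sub>i\<^sub>j = d\<kappa>\<^sub>i\<^sub>j \<surd>(det g) \<gamma>\<^sub>n\<^sub>k\<close> (lemma \<open>rho_cov_eq\<close>) and
  \<open>L\<^sub>k\<^sub>n\<^sub>i\<^sub>j = d\<kappa>\<^sub>i\<^sub>j \<surd>(det a) \<gamma>\<^sub>n\<^sub>k\<close> (lemma \<open>curv_L_cov_eq\<close>). Their quotient is the asserted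
  factor.

  On the Finsler side, \<open>F\<close> and \<open>\<theta>\<close> are polar coordinates of the tangent planes. The connection
  is made so that its horizontal derivations \<open>d\<^sub>n\<close> satisfy \<open>d\<^sub>n F = 0\<close> and \<open>d\<^sub>n \<theta> = \<kappa>\<^sub>n\<close>. Hence
  the commutator of two of them is \<open>d\<kappa>\<close> times \<open>\<partial>/\<partial>\<theta>\<close>, whose components are \<open>F m\<^sup>k\<close>; this is the
  tensor \<open>M\<close> (lemma \<open>curv_M_eq\<close>). The remaining part of the curvature is a vertical derivative,
  \<open>E\<^sub>k\<^sup>n\<^sub>i\<^sub>j = - \<partial>M\<^sup>n\<^sub>i\<^sub>j/\<partial>y\<^sup>k\<close> (lemma \<open>curv_E_eq\<close>). So \<open>\<rho>\<close> is \<open>- d\<kappa>\<close> times the derivative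
  \<open>\<partial>(F m\<^sup>n)/\<partial>y\<^sup>k + F m\<^sup>h C\<^sup>n\<^sub>h\<^sub>k\<close>, and in dimension two the Cartan tensor \<open>C\<close>, which is
  annihilated by \<open>y\<close>, cancels everything in it except minus the area form (lemma
  \<open>rot_vertical_derivative\<close>).

  On the Riemannian side, the term with \<open>T\<close> in the connection \<open>L\<close> replaces the rotation
  coefficients of the orthonormal frame \<open>(b, n)\<close> by \<open>- \<kappa>\<close> (lemma \<open>frame_equations\<close>). Plane
  rotations commute, so the curvature in this frame is just the exterior derivative of the
  connection form (lemma \<open>L_curvature_frame\<close>).

  All these identities are obtained by differentiating identities that hold on open sets, and
  they rest on the symmetry of second derivatives (lemma \<open>dir_deriv_commute\<close>). They need \<open>N\<close> of
  class \<open>C\<^sup>2\<close>, which is what \<open>\<kappa>\<close> of class \<open>C\<^sup>2\<close> and \<open>\<theta>\<close> of class \<open>C\<^sup>3\<close> provide.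
\<close>

section \<open>Calculus of functions of class \<open>C\<^sup>r\<close>\<close>

definition dir_deriv :: "'a::real_normed_vector \<Rightarrow> ('a \<Rightarrow> real) \<Rightarrow> 'a \<Rightarrow> real" where
  "dir_deriv v f z = frechet_derivative f (at z) v"

lemma dir_deriv_eqI: "(f has_derivative f') (at z) \<Longrightarrow> dir_deriv v f z = f' v"
  unfolding dir_deriv_def using frechet_derivative_at by metis

lemma C_k_on_Suc:
  "C_k_on (Suc r) S f \<longleftrightarrow> (\<forall>z\<in>S. f differentiable (at z)) \<and> (\<forall>v. C_k_on r S (dir_deriv v f))"
  by (simp add: dir_deriv_def[abs_def])

declare C_k_on.simps(2) [simp del]

lemma C_k_on_differentiable: "C_k_on (Suc r) S f \<Longrightarrow> z \<in> S \<Longrightarrow> f differentiable (at z)"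
  by (simp add: C_k_on_Suc)

lemma C_k_on_dir_deriv: "C_k_on (Suc r) S f \<Longrightarrow> C_k_on r S (dir_deriv v f)"
  by (simp add: C_k_on_Suc)

lemma dir_deriv_cong:
  assumes "open S" "z \<in> S" "\<And>w. w \<in> S \<Longrightarrow> f w = g w"
  shows "dir_deriv v f z = dir_deriv v g z"
proof -
  have "(f has_derivative f') (at z) \<longleftrightarrow> (g has_derivative f') (at z)" for f'
    using assms by (metis has_derivative_transform_within_open)
  then show ?thesis
    by (simp add: dir_deriv_def frechet_derivative_def)
qed

lemma C_k_on_cong:
  assumes "open S" "\<And>w. w \<in> S \<Longrightarrow> f w = g w" "C_k_on r S f"
  shows "C_k_on r S g"
  using assms(2,3)
proof (induction r arbitrary: f g)
  case 0
  then show ?case by (simp cong: continuous_on_cong)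
next
  case (Suc r)
  have "g differentiable (at z)" if "z \<in> S" for z
    using C_k_on_differentiable[OF Suc.prems(2) that] Suc.prems(1) that \<open>open S\<close>
    unfolding differentiable_def by (metis has_derivative_transform_within_open)
  moreover have "C_k_on r S (dir_deriv v g)" for v
    by (rule Suc.IH[of "dir_deriv v f"])
      (use Suc.prems \<open>open S\<close> in \<open>auto intro: dir_deriv_cong C_k_on_dir_deriv\<close>)
  ultimately show ?case by (simp add: C_k_on_Suc)
qed

lemma C_k_on_subset: "C_k_on r S f \<Longrightarrow> T \<subseteq> S \<Longrightarrow> C_k_on r T f"
  by (induction r arbitrary: f) (auto simp: C_k_on_Suc intro: continuous_on_subset)

lemma C_k_on_SucD: "C_k_on (Suc r) S f \<Longrightarrow> C_k_on r S f"
proof (induction r arbitrary: f)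
  case 0
  then show ?case
    by (auto intro!: differentiable_imp_continuous_on differentiable_at_imp_differentiable_on
        simp: C_k_on_Suc)
next
  case (Suc r)
  then show ?case by (subst C_k_on_Suc) (auto simp: C_k_on_Suc[of "Suc r"])
qed

lemma C_k_on_le: "C_k_on r S f \<Longrightarrow> q \<le> r \<Longrightarrow> C_k_on q S f"
  by (induction r) (auto simp: le_Suc_eq dest: C_k_on_SucD)

lemma C_k_on_const [simp]: "C_k_on r S (\<lambda>_. c)"
proof (induction r arbitrary: c)
  case (Suc r)
  have "dir_deriv v (\<lambda>_::'a. c) = (\<lambda>_. 0)" for v
    by (auto simp: dir_deriv_def)
  with Suc show ?case by (simp add: C_k_on_Suc)
qed simp

lemma C_k_on_linear:
  assumes "bounded_linear f" shows "C_k_on r S f"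
proof (cases r)
  case 0
  then show ?thesis using assms by (simp add: linear_continuous_on)
next
  case (Suc q)
  have "dir_deriv v f = (\<lambda>_. f v)" for v
    using bounded_linear_imp_has_derivative[OF assms] by (auto intro!: dir_deriv_eqI)
  then show ?thesis
    using bounded_linear_imp_differentiable[OF assms] by (simp add: Suc C_k_on_Suc)
qed

lemma has_derivative_dir_deriv: "f differentiable (at z) \<Longrightarrow> (f has_derivative (\<lambda>v. dir_deriv v f
  z)) (at z)"
  unfolding dir_deriv_def by (simp add: frechet_derivative_works)

lemma dir_deriv_add:
  "f differentiable (at z) \<Longrightarrow> g differentiable (at z) \<Longrightarrow>
    dir_deriv v (\<lambda>z. f z + g z) z = dir_deriv v f z + dir_deriv v g z"
  by (rule dir_deriv_eqI[OF has_derivative_add[OF has_derivative_dir_deriv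
    has_derivative_dir_deriv]])

lemma dir_deriv_minus:
  "f differentiable (at z) \<Longrightarrow> dir_deriv v (\<lambda>z. - f z) z = - dir_deriv v f z"
  by (rule dir_deriv_eqI[OF has_derivative_minus[OF has_derivative_dir_deriv]])

lemma dir_deriv_mult:
  "f differentiable (at z) \<Longrightarrow> g differentiable (at z) \<Longrightarrow>
    dir_deriv v (\<lambda>z. f z * g z) z = f z * dir_deriv v g z + dir_deriv v f z * g z"
  by (rule dir_deriv_eqI[OF has_derivative_mult[OF has_derivative_dir_deriv
    has_derivative_dir_deriv]])

lemma C_k_on_add:
  assumes "open S" "C_k_on r S f" "C_k_on r S g"
  shows "C_k_on r S (\<lambda>z. f z + g z)"
  using assms(2,3)
proof (induction r arbitrary: f g)
  case (Suc r)
  have "C_k_on r S (dir_deriv v (\<lambda>z. f z + g z))" for v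
    by (rule C_k_on_cong[OF \<open>open S\<close> _ Suc.IH[OF C_k_on_dir_deriv C_k_on_dir_deriv, OF Suc.prems]])
      (use Suc.prems in \<open>simp add: dir_deriv_add C_k_on_Suc\<close>)
  then show ?case
    using Suc.prems by (auto simp: C_k_on_Suc)
qed (auto intro: continuous_on_add)

lemma C_k_on_mult:
  assumes "open S" "C_k_on r S f" "C_k_on r S g"
  shows "C_k_on r S (\<lambda>z. f z * g z)"
  using assms(2,3)
proof (induction r arbitrary: f g)
  case (Suc r)
  have "C_k_on r S (dir_deriv v (\<lambda>z. f z * g z))" for v
  proof (rule C_k_on_cong[OF \<open>open S\<close>])
    show "C_k_on r S (\<lambda>z. f z * dir_deriv v g z + dir_deriv v f z * g z)"
      by (rule C_k_on_add[OF \<open>open S\<close> Suc.IH[OF C_k_on_SucD C_k_on_dir_deriv]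
            Suc.IH[OF C_k_on_dir_deriv C_k_on_SucD]]) (fact Suc.prems)+
  qed (use Suc.prems in \<open>simp add: dir_deriv_mult C_k_on_Suc\<close>)
  then show ?case
    using Suc.prems by (auto simp: C_k_on_Suc)
qed (auto intro: continuous_on_mult)

lemma C_k_on_minus:
  assumes "open S" "C_k_on r S f" shows "C_k_on r S (\<lambda>z. - f z)"
  using C_k_on_mult[OF assms(1) C_k_on_const[of r S "-1"] assms(2)] by simp

lemma C_k_on_diff:
  assumes "open S" "C_k_on r S f" "C_k_on r S g" shows "C_k_on r S (\<lambda>z. f z - g z)"
  using C_k_on_add[OF assms(1,2) C_k_on_minus[OF assms(1,3)]] by simp

lemma C_k_on_sum:
  assumes "open S" "\<And>i. i \<in> I \<Longrightarrow> C_k_on r S (f i)"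
  shows "C_k_on r S (\<lambda>z. \<Sum>i\<in>I. f i z)"
  using assms(2) by (induction I rule: infinite_finite_induct) (auto intro: C_k_on_add \<open>open S\<close>)

text \<open>
  The chain rule writes a directional derivative of the composite as a sum of products of a
  directional derivative of a coordinate of \<open>h\<close> with a composite of a derivative of \<open>f\<close>; both
  factors have one derivative less, so induction on \<open>r\<close> closes up for all \<open>f\<close> at once. This is
  what makes the osculating metric \<open>x \<mapsto> g (x, b x)\<close> differentiable.
\<close>

lemma C_k_on_compose:
  fixes f :: "'b::euclidean_space \<Rightarrow> real" and h :: "'a::euclidean_space \<Rightarrow> 'b"
  assumes "open S" "C_k_on r T f" "\<And>i. i \<in> Basis \<Longrightarrow> C_k_on r S (\<lambda>z. h z \<bullet> i)" "h ` S \<subseteq> T"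
  shows "C_k_on r S (\<lambda>z. f (h z))"
  using assms(2,3)
proof (induction r arbitrary: f)
  case 0
  then have "continuous_on S h"
    using continuous_on_componentwise[of S h] by simp
  with 0 \<open>h ` S \<subseteq> T\<close> show ?case
    using continuous_on_compose2[of T f S h] by simp
next
  case (Suc r)
  have h: "h differentiable (at z)" if "z \<in> S" for z
    using Suc.prems(2) that by (subst differentiable_componentwise_within) (auto simp: C_k_on_Suc)
  have f: "f differentiable (at (h z))" if "z \<in> S" for z
    using Suc.prems(1) that \<open>h ` S \<subseteq> T\<close> by (auto simp: C_k_on_Suc)
  have D: "((\<lambda>z. f (h z)) has_derivative (\<lambda>v. dir_deriv (frechet_derivative h (at z) v) f (h z)))
    (at z)"
    if "z \<in> S" for z
    using has_derivative_compose[OF h[OF that, unfolded frechet_derivative_works]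
        has_derivative_dir_deriv[OF f[OF that]]] .
  have chain: "dir_deriv v (\<lambda>z. f (h z)) z
    = (\<Sum>i\<in>Basis. dir_deriv v (\<lambda>z. h z \<bullet> i) z * dir_deriv i f (h z))"
    if "z \<in> S" for v z
  proof -
    have lin: "linear (frechet_derivative f (at (h z)))"
      using f[OF that] by (rule linear_frechet_derivative)
    have comp: "dir_deriv v (\<lambda>z. h z \<bullet> i) z = frechet_derivative h (at z) v \<bullet> i" for i
      by (rule dir_deriv_eqI)
        (use h[OF that] in \<open>simp add: has_derivative_inner_left frechet_derivative_works\<close>)
    have "dir_deriv v (\<lambda>z. f (h z)) z
      = frechet_derivative f (at (h z)) (frechet_derivative h (at z) v)"
      by (simp only: dir_deriv_eqI[OF D[OF that]]) (simp add: dir_deriv_def)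
    also have "\<dots> = frechet_derivative f (at (h z))
        (\<Sum>i\<in>Basis. (frechet_derivative h (at z) v \<bullet> i) *\<^sub>R i)"
      by (simp add: euclidean_representation)
    also have "\<dots> = (\<Sum>i\<in>Basis. dir_deriv v (\<lambda>z. h z \<bullet> i) z * dir_deriv i f (h z))"
      by (simp add: linear_sum[OF lin] linear_cmul[OF lin] comp[unfolded dir_deriv_def]
        dir_deriv_def)
    finally show ?thesis .
  qed
  have "C_k_on r S (dir_deriv v (\<lambda>z. f (h z)))" for v
  proof (rule C_k_on_cong[OF \<open>open S\<close>])
    show "C_k_on r S (\<lambda>z. \<Sum>i\<in>Basis. dir_deriv v (\<lambda>z. h z \<bullet> i) z * dir_deriv i f (h z))"
    proof (intro C_k_on_sum C_k_on_mult \<open>open S\<close>)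
      fix i :: 'b assume i: "i \<in> Basis"
      show "C_k_on r S (dir_deriv v (\<lambda>z. h z \<bullet> i))"
        using Suc.prems(2)[OF i] by (rule C_k_on_dir_deriv)
      show "C_k_on r S (\<lambda>z. dir_deriv i f (h z))"
        by (rule Suc.IH[OF C_k_on_dir_deriv[OF Suc.prems(1)] C_k_on_SucD[OF Suc.prems(2)]])
    qed
  qed (simp add: chain)
  moreover have "(\<lambda>z. f (h z)) differentiable (at z)" if "z \<in> S" for z
    using D[OF that] by (auto simp: differentiable_def)
  ultimately show ?case by (simp add: C_k_on_Suc)
qed

lemma C_k_on_compose_real:
  assumes "open S" "C_k_on r T f" "C_k_on r S h" "\<And>z. z \<in> S \<Longrightarrow> h z \<in> T"
  shows "C_k_on r S (\<lambda>z. f (h z :: real))"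
  by (rule C_k_on_compose[of _ _ T]) (use assms in auto)

text \<open>
  The induction on \<open>r\<close> works because the derivatives of \<open>inverse\<close> and of \<open>sqrt\<close> are again
  polynomials in \<open>inverse\<close>, respectively in \<open>inverse \<circ> sqrt\<close>.
\<close>

lemma C_k_on_inverse_real: "C_k_on r (- {0}) (inverse :: real \<Rightarrow> real)"
proof (induction r)
  case 0
  then show ?case by (auto intro!: continuous_intros)
next
  case (Suc r)
  have D: "(inverse has_derivative (\<lambda>v. - (inverse z * v * inverse z))) (at z)"
    if "z \<noteq> 0" for z :: real
    using that by (rule has_derivative_inverse')
  have "C_k_on r (- {0}) (dir_deriv v (inverse :: real \<Rightarrow> real))" for v
  proof (rule C_k_on_cong)
    show "C_k_on r (- {0}) (\<lambda>z. - (inverse z * v * inverse z))"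
      by (intro C_k_on_minus C_k_on_mult Suc.IH) auto
  qed (auto simp: dir_deriv_eqI[OF D])
  moreover have "(inverse :: real \<Rightarrow> real) differentiable (at z)" if "z \<noteq> 0" for z
    using D[OF that] by (rule differentiableI)
  ultimately show ?case by (simp add: C_k_on_Suc)
qed

lemma C_k_on_sqrt_real: "C_k_on r {0<..} sqrt"
proof (induction r)
  case 0
  then show ?case by (auto intro!: continuous_intros)
next
  case (Suc r)
  have D: "(sqrt has_derivative (*) (inverse (sqrt z) / 2)) (at z)" if "z > 0" for z :: real
    using DERIV_real_sqrt[OF that] by (simp add: has_field_derivative_def)
  have "C_k_on r {0<..} (dir_deriv v sqrt)" for v
  proof (rule C_k_on_cong)
    show "C_k_on r {0<..} (\<lambda>z. v * (inverse (sqrt z) * (1 / 2)))"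
      by (intro C_k_on_mult C_k_on_compose_real[OF _ C_k_on_inverse_real, where h
        = sqrt] Suc.IH) auto
  qed (auto simp: dir_deriv_eqI[OF D])
  moreover have "sqrt differentiable (at z)" if "z > 0" for z
    using D[OF that] by (rule differentiableI)
  ultimately show ?case by (simp add: C_k_on_Suc)
qed

lemma C_k_on_divide:
  assumes "open S" "C_k_on r S f" "C_k_on r S g" "\<And>z. z \<in> S \<Longrightarrow> g z \<noteq> 0"
  shows "C_k_on r S (\<lambda>z. f z / g z)"
  unfolding divide_inverse
  by (intro C_k_on_mult C_k_on_compose_real[OF _ C_k_on_inverse_real, where h = g] assms)
    (use assms in auto)

lemma C_k_on_sqrt:
  assumes "open S" "C_k_on r S f" "\<And>z. z \<in> S \<Longrightarrow> f z > 0"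
  shows "C_k_on r S (\<lambda>z. sqrt (f z))"
  by (rule C_k_on_compose_real[OF _ C_k_on_sqrt_real]) (use assms in auto)

lemma DERIV_line:
  assumes "f differentiable (at (p + s *\<^sub>R u))"
  shows "((\<lambda>s. f (p + s *\<^sub>R u)) has_real_derivative dir_deriv u f (p + s *\<^sub>R u)) (at s)"
proof -
  have "((\<lambda>s. p + s *\<^sub>R u) has_derivative (\<lambda>t. t *\<^sub>R u)) (at s)"
    by (auto intro!: derivative_eq_intros)
  from has_derivative_compose[OF this has_derivative_dir_deriv[OF assms]]
  have "((\<lambda>s. f (p + s *\<^sub>R u)) has_derivative (\<lambda>t. dir_deriv (t *\<^sub>R u) f (p + s *\<^sub>R u))) (at s)" .
  moreover have "(\<lambda>t. dir_deriv (t *\<^sub>R u) f (p + s *\<^sub>R u)) = (*) (dir_deriv u f (p + s *\<^sub>R u))"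
    using linear_frechet_derivative[OF assms] by (auto simp: dir_deriv_def linear_cmul)
  ultimately show ?thesis
    by (simp add: has_field_derivative_def)
qed

text \<open>
  Two applications of the mean value theorem turn the second difference, which is symmetric in
  the two directions, into a value of the mixed derivative at a nearby point.
\<close>

lemma second_difference_tendsto:
  fixes f :: "'a::euclidean_space \<Rightarrow> real"
  assumes "open S" "C_k_on 2 S f" "z \<in> S"
  shows "((\<lambda>h. (f (z + h *\<^sub>R u + h *\<^sub>R v) - f (z + h *\<^sub>R u) - f (z + h *\<^sub>R v) + f z) / h\<^sup>2)
           \<longlongrightarrow> dir_deriv v (dir_deriv u f) z) (at_right 0)"
proof (rule tendstoI)
  fix e :: real assume "e > 0"
  let ?G = "dir_deriv v (dir_deriv u f)"
  have smooth: "C_k_on (Suc (Suc 0)) S f"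
    using assms(2) by (simp add: numeral_2_eq_2)
  have "continuous_on S ?G"
    using C_k_on_dir_deriv[OF C_k_on_dir_deriv[OF smooth]] by simp
  then have "isCont ?G z"
    using assms by (simp add: continuous_on_eq_continuous_at)
  then obtain d1 where d1: "d1 > 0" "\<And>w. dist w z < d1 \<Longrightarrow> dist (?G w) (?G z) < e"
    using \<open>e > 0\<close> unfolding continuous_at_eps_delta by metis
  obtain d2 where d2: "d2 > 0" "ball z d2 \<subseteq> S"
    using assms openE by blast
  define d where "d = min d1 d2 / (norm u + norm v + 1)"
  have "d > 0"
    using d1 d2 by (auto simp: d_def intro!: divide_pos_pos add_nonneg_pos)
  have near: "dist (z + s *\<^sub>R u + t *\<^sub>R v) z < min d1 d2"
    if "0 \<le> s" "s \<le> h" "0 \<le> t" "t \<le> h" "0 < h" "h < d" for s t h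
  proof -
    have "dist (z + s *\<^sub>R u + t *\<^sub>R v) z = norm (s *\<^sub>R u + t *\<^sub>R v)"
      by (simp add: dist_norm add.assoc)
    also have "\<dots> \<le> s * norm u + t * norm v"
      using norm_triangle_ineq[of "s *\<^sub>R u" "t *\<^sub>R v"] that by simp
    also have "\<dots> \<le> h * norm u + h * norm v"
      using that by (intro add_mono mult_right_mono) auto
    also have "\<dots> \<le> h * (norm u + norm v + 1)"
      using that by (simp add: algebra_simps)
    also have "\<dots> < d * (norm u + norm v + 1)"
      using that by (intro mult_strict_right_mono) (auto intro: add_nonneg_pos)
    also have "\<dots> = min d1 d2"
      using add_nonneg_pos[of "norm u + norm v" 1] by (simp add: d_def)
    finally show ?thesis .
  qed
  have inS: "z + s *\<^sub>R u + t *\<^sub>R v \<in> S"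
    if "0 \<le> s" "s \<le> h" "0 \<le> t" "t \<le> h" "0 < h" "h < d" for s t h
    using near[OF that] d2 by (auto simp: dist_commute)
  have df: "f differentiable (at w)" "dir_deriv u f differentiable (at w)" if "w \<in> S" for w
    using smooth that C_k_on_dir_deriv[OF smooth, of u] by (auto intro: C_k_on_differentiable)
  have "dist ((f (z + h *\<^sub>R u + h *\<^sub>R v) - f (z + h *\<^sub>R u) - f (z + h *\<^sub>R v)
    + f z) / h\<^sup>2) (?G z) < e"
    if h: "0 < h" "h < d" for h
  proof -
    let ?\<phi> = "\<lambda>s. f (z + h *\<^sub>R v + s *\<^sub>R u) - f (z + s *\<^sub>R u)"
    have "\<exists>\<xi>>0. \<xi> < h \<and> ?\<phi> h - ?\<phi> 0 =
        (h - 0) * (dir_deriv u f (z + h *\<^sub>R v + \<xi> *\<^sub>R u) - dir_deriv u f (z + \<xi> *\<^sub>R u))"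
    proof (rule MVT2[OF h(1)])
      fix s assume s: "0 \<le> s" "s \<le> h"
      show "(?\<phi> has_real_derivative dir_deriv u f (z + h *\<^sub>R v + s *\<^sub>R u) - dir_deriv u f (z
        + s *\<^sub>R u)) (at s)"
        using inS[of s h h] inS[of s h 0] s h
        by (intro DERIV_diff DERIV_line df) (auto simp: ac_simps)
    qed
    then obtain \<xi> where \<xi>: "0 < \<xi>" "\<xi> < h"
      and 1: "?\<phi> h - ?\<phi> 0 = h * (dir_deriv u f (z + h *\<^sub>R v + \<xi> *\<^sub>R u) - dir_deriv u f (z
        + \<xi> *\<^sub>R u))"
      by auto
    have "\<exists>\<eta>>0. \<eta> < h \<and> dir_deriv u f (z + \<xi> *\<^sub>R u + h *\<^sub>R v) - dir_deriv u f (z + \<xi> *\<^sub>R u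
      + 0 *\<^sub>R v) =
        (h - 0) * ?G (z + \<xi> *\<^sub>R u + \<eta> *\<^sub>R v)"
    proof (rule MVT2[OF h(1)])
      fix t assume t: "0 \<le> t" "t \<le> h"
      show "((\<lambda>t. dir_deriv u f (z + \<xi> *\<^sub>R u + t *\<^sub>R v)) has_real_derivative
              ?G (z + \<xi> *\<^sub>R u + t *\<^sub>R v)) (at t)"
        using inS[of \<xi> h t] t h \<xi> by (intro DERIV_line df) auto
    qed
    then obtain \<eta> where \<eta>: "0 < \<eta>" "\<eta> < h"
      and 2: "dir_deriv u f (z + \<xi> *\<^sub>R u + h *\<^sub>R v) - dir_deriv u f (z + \<xi> *\<^sub>R u) =
        h * ?G (z + \<xi> *\<^sub>R u + \<eta> *\<^sub>R v)"
      by auto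
    have "f (z + h *\<^sub>R u + h *\<^sub>R v) - f (z + h *\<^sub>R u) - f (z + h *\<^sub>R v) + f z
        = h * (h * ?G (z + \<xi> *\<^sub>R u + \<eta> *\<^sub>R v))"
      using 1 2 by (simp add: ac_simps)
    then have "(f (z + h *\<^sub>R u + h *\<^sub>R v) - f (z + h *\<^sub>R u) - f (z + h *\<^sub>R v) + f z) / h\<^sup>2
        = ?G (z + \<xi> *\<^sub>R u + \<eta> *\<^sub>R v)"
      using h by (simp add: power2_eq_square)
    then show ?thesis
      using d1(2) near[of \<xi> h \<eta>] \<xi> \<eta> h by auto
  qed
  then show "\<forall>\<^sub>F h in at_right 0. dist ((f (z + h *\<^sub>R u + h *\<^sub>R v) - f (z + h *\<^sub>R u)
      - f (z + h *\<^sub>R v) + f z) / h\<^sup>2) (?G z) < e"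
    using eventually_at_right_less[of 0] \<open>d > 0\<close>
    by (auto simp: eventually_at_right_field)
qed

text \<open>
  Symmetry of second derivatives (Clairaut, Schwarz).
\<close>

lemma dir_deriv_commute:
  fixes f :: "'a::euclidean_space \<Rightarrow> real"
  assumes "open S" "C_k_on 2 S f" "z \<in> S"
  shows "dir_deriv v (dir_deriv u f) z = dir_deriv u (dir_deriv v f) z"
proof (rule tendsto_unique[OF _ second_difference_tendsto[OF assms, of u v]])
  show "((\<lambda>h. (f (z + h *\<^sub>R u + h *\<^sub>R v) - f (z + h *\<^sub>R u) - f (z + h *\<^sub>R v) + f z) / h\<^sup>2)
           \<longlongrightarrow> dir_deriv u (dir_deriv v f) z) (at_right 0)"
    using second_difference_tendsto[OF assms, of v u] by (simp add: algebra_simps)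
qed simp

section \<open>Partial derivatives on the base and on the tangent bundle\<close>

lemma pd_eq_dir_deriv: "pd n f = dir_deriv (axis n 1) f"
  by (simp add: pd_def dir_deriv_def fun_eq_iff)

lemma C_k_on_pd: "C_k_on (Suc r) S f \<Longrightarrow> C_k_on r S (pd n f)"
  by (simp add: pd_eq_dir_deriv C_k_on_dir_deriv)

lemma pd_cong:
  "open S \<Longrightarrow> x \<in> S \<Longrightarrow> (\<And>w. w \<in> S \<Longrightarrow> f w = g w) \<Longrightarrow> pd n f x = pd n g x"
  unfolding pd_eq_dir_deriv by (rule dir_deriv_cong)

lemma pd_commute: "open S \<Longrightarrow> C_k_on 2 S f \<Longrightarrow> x \<in> S \<Longrightarrow> pd i (pd j f) x = pd j (pd i f) x"
  unfolding pd_eq_dir_deriv by (rule dir_deriv_commute)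

lemma pd_const [simp]: "pd n (\<lambda>_. c) x = 0"
  by (simp add: pd_def)

lemma pd_coordinate [simp]: "pd n (\<lambda>y. y $ i) y = (if i = n then 1 else 0)"
  unfolding pd_eq_dir_deriv
  by (subst dir_deriv_eqI[OF bounded_linear_imp_has_derivative])
    (auto simp: axis_def bounded_linear_vec_nth)

lemma
  assumes "f differentiable (at x)"
  shows pd_minus: "pd n (\<lambda>x. - f x) x = - pd n f x"
    and pd_add: "g differentiable (at x) \<Longrightarrow> pd n (\<lambda>x. f x + g x) x = pd n f x + pd n g x"
    and pd_mult: "g differentiable (at x) \<Longrightarrow> pd n (\<lambda>x. f x * g x) x
      = f x * pd n g x + pd n f x * g x"
  using assms by (simp_all add: pd_eq_dir_deriv dir_deriv_minus dir_deriv_add dir_deriv_mult)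

lemma dir_deriv_eq_sum_pd:
  fixes v :: "real^2"
  assumes "f differentiable (at x)"
  shows "dir_deriv v f x = (\<Sum>i\<in>UNIV. v $ i * pd i f x)"
proof -
  have lin: "linear (frechet_derivative f (at x))"
    using assms by (rule linear_frechet_derivative)
  have "dir_deriv v f x = frechet_derivative f (at x) (\<Sum>i\<in>UNIV. v $ i *\<^sub>R axis i 1)"
    using basis_expansion[of v] by (simp add: dir_deriv_def scalar_mult_eq_scaleR)
  also have "\<dots> = (\<Sum>i\<in>UNIV. v $ i * pd i f x)"
    by (simp add: linear_sum[OF lin] linear_cmul[OF lin] pd_def)
  finally show ?thesis .
qed

text \<open>
  Smoothness in both arguments jointly, for functions in the curried form on which \<open>pdx\<close> and
  \<open>pdy\<close> operate. Joint smoothness is needed because the derivatives in \<open>x\<close> and in \<open>y\<close> have to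
  commute.
\<close>

definition smooth :: "nat \<Rightarrow> ((real^2) \<times> (real^2)) set \<Rightarrow> (real^2 \<Rightarrow> real^2 \<Rightarrow> real) \<Rightarrow> bool" where
  "smooth r S f \<longleftrightarrow> C_k_on r S (\<lambda>(x, y). f x y)"

lemma smooth_le: "smooth r S f \<Longrightarrow> q \<le> r \<Longrightarrow> smooth q S f"
  by (auto simp: smooth_def intro: C_k_on_le)

lemma smooth_const [simp]: "smooth r S (\<lambda>x y. c)"
  unfolding smooth_def case_prod_beta by (rule C_k_on_const)

lemma smooth_fibre_coordinate [simp]: "smooth r S (\<lambda>x y. y $ i)"
  unfolding smooth_def case_prod_beta
  by (intro C_k_on_linear bounded_linear_compose[OF bounded_linear_vec_nth bounded_linear_snd])

lemma smooth_base:
  assumes "open S" "C_k_on r U f" "S \<subseteq> U \<times> UNIV"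
  shows "smooth r S (\<lambda>x y. f x)"
  unfolding smooth_def case_prod_beta
proof (rule C_k_on_compose[OF assms(1,2)])
  show "C_k_on r S (\<lambda>z. fst z \<bullet> i)" for i
    by (intro C_k_on_linear bounded_linear_compose[OF bounded_linear_inner_left bounded_linear_fst])
qed (use assms(3) in auto)

lemma smooth_cong:
  assumes "open S" "\<And>x y. (x, y) \<in> S \<Longrightarrow> f x y = g x y" "smooth r S f"
  shows "smooth r S g"
  using assms(3) unfolding smooth_def by (rule C_k_on_cong[OF assms(1), rotated])
    (use assms(2) in auto)

lemma smooth_add: "open S \<Longrightarrow> smooth r S f \<Longrightarrow> smooth r S g \<Longrightarrow> smooth r S (\<lambda>x y. f x y + g x y)"
  unfolding smooth_def case_prod_beta by (rule C_k_on_add)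

lemma smooth_minus: "open S \<Longrightarrow> smooth r S f \<Longrightarrow> smooth r S (\<lambda>x y. - f x y)"
  unfolding smooth_def case_prod_beta by (rule C_k_on_minus)

lemma smooth_diff: "open S \<Longrightarrow> smooth r S f \<Longrightarrow> smooth r S g \<Longrightarrow> smooth r S (\<lambda>x y. f x y - g x y)"
  unfolding smooth_def case_prod_beta by (rule C_k_on_diff)

lemma smooth_mult: "open S \<Longrightarrow> smooth r S f \<Longrightarrow> smooth r S g \<Longrightarrow> smooth r S (\<lambda>x y. f x y * g x y)"
  unfolding smooth_def case_prod_beta by (rule C_k_on_mult)

lemma smooth_divide:
  "open S \<Longrightarrow> smooth r S f \<Longrightarrow> smooth r S g \<Longrightarrow> (\<And>x y. (x, y) \<in> S \<Longrightarrow> g x y \<noteq> 0) \<Longrightarrow>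
    smooth r S (\<lambda>x y. f x y / g x y)"
  unfolding smooth_def case_prod_beta by (rule C_k_on_divide) auto

lemma smooth_sqrt:
  "open S \<Longrightarrow> smooth r S f \<Longrightarrow> (\<And>x y. (x, y) \<in> S \<Longrightarrow> f x y > 0) \<Longrightarrow>
    smooth r S (\<lambda>x y. sqrt (f x y))"
  unfolding smooth_def case_prod_beta by (rule C_k_on_sqrt) auto

lemma smooth_section:
  assumes "open U" "smooth r S f" "\<And>i. C_k_on r U (\<lambda>x. c x $ i)" "\<And>x. x \<in> U \<Longrightarrow> (x, c x) \<in> S"
  shows "C_k_on r U (\<lambda>x. f x (c x))"
proof -
  have "C_k_on r U (\<lambda>x. (x, c x) \<bullet> i)" if "i \<in> Basis" for i
  proof -
    obtain u k where i: "i = (u, 0) \<or> i = (0, axis k 1)"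
      using \<open>i \<in> Basis\<close> by (auto simp: Basis_prod_def Basis_vec_def)
    have "C_k_on r U (\<lambda>x. x \<bullet> u)"
      by (intro C_k_on_linear bounded_linear_inner_left)
    with i show ?thesis
      using assms(3)[of k] by (auto simp: inner_axis)
  qed
  from C_k_on_compose[OF \<open>open U\<close> assms(2)[unfolded smooth_def] this] show ?thesis
    using assms(4) by force
qed

text \<open>
  The partial maps are the composites with affine embeddings of the base and of the fibre. So
  \<open>pdx\<close> and \<open>pdy\<close> are directional derivatives on the total space, for which symmetry is
  available.
\<close>

lemma
  assumes "smooth (Suc r) S f" "(x, y) \<in> S"
  shows smooth_differentiable_x: "(\<lambda>x'. f x' y) differentiable (at x)"
    and smooth_differentiable_y: "f x differentiable (at y)"
    and pdx_eq_dir_deriv: "pdx n f x y = dir_deriv (axis n 1, 0) (\<lambda>(x, y). f x y) (x, y)"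
    and pdy_eq_dir_deriv: "pdy n f x y = dir_deriv (0, axis n 1) (\<lambda>(x, y). f x y) (x, y)"
proof -
  have "(\<lambda>(x, y). f x y) differentiable (at (x, y))"
    using assms unfolding smooth_def by (rule C_k_on_differentiable)
  note D = has_derivative_dir_deriv[OF this]
  have "((\<lambda>x'. (x', y)) has_derivative (\<lambda>v. (v, 0))) (at x)"
    by (auto intro!: derivative_eq_intros)
  from has_derivative_compose[OF this D]
  have X: "((\<lambda>x'. f x' y) has_derivative (\<lambda>v. dir_deriv (v, 0) (\<lambda>(x, y). f x y) (x, y))) (at x)"
    by simp
  have "((\<lambda>y'. (x, y')) has_derivative (\<lambda>v. (0, v))) (at y)"
    by (auto intro!: derivative_eq_intros)
  from has_derivative_compose[OF this D]
  have Y: "(f x has_derivative (\<lambda>v. dir_deriv (0, v) (\<lambda>(x, y). f x y) (x, y))) (at y)"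
    by simp
  show "(\<lambda>x'. f x' y) differentiable (at x)" "f x differentiable (at y)"
    using X Y by (auto intro: differentiableI)
  show "pdx n f x y = dir_deriv (axis n 1, 0) (\<lambda>(x, y). f x y) (x, y)"
    "pdy n f x y = dir_deriv (0, axis n 1) (\<lambda>(x, y). f x y) (x, y)"
    unfolding pdx_def pdy_def pd_eq_dir_deriv using dir_deriv_eqI[OF X] dir_deriv_eqI[OF Y]
      by simp_all
qed

lemma smooth_pdx:
  assumes "open S" "smooth (Suc r) S f" shows "smooth r S (pdx n f)"
  unfolding smooth_def
  by (rule C_k_on_cong[OF \<open>open S\<close> _ C_k_on_dir_deriv[OF assms(2)[unfolded smooth_def]]])
    (use assms in \<open>auto simp: pdx_eq_dir_deriv\<close>)

lemma smooth_pdy: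
  assumes "open S" "smooth (Suc r) S f" shows "smooth r S (pdy n f)"
  unfolding smooth_def
  by (rule C_k_on_cong[OF \<open>open S\<close> _ C_k_on_dir_deriv[OF assms(2)[unfolded smooth_def]]])
    (use assms in \<open>auto simp: pdy_eq_dir_deriv\<close>)

lemma pdx_cong:
  assumes "open S" "(x, y) \<in> S" "\<And>x y. (x, y) \<in> S \<Longrightarrow> f x y = g x y"
  shows "pdx n f x y = pdx n g x y"
  unfolding pdx_def
proof (rule pd_cong)
  show "open ((\<lambda>x. (x, y)) -` S)"
    by (intro open_vimage \<open>open S\<close> continuous_intros)
qed (use assms in auto)

lemma pdy_cong:
  assumes "open S" "(x, y) \<in> S" "\<And>x y. (x, y) \<in> S \<Longrightarrow> f x y = g x y"
  shows "pdy n f x y = pdy n g x y"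
  unfolding pdy_def
proof (rule pd_cong)
  show "open ((\<lambda>y. (x, y)) -` S)"
    by (intro open_vimage \<open>open S\<close> continuous_intros)
qed (use assms in auto)

lemma
  assumes "open S" "smooth 2 S f" "(x, y) \<in> S"
  shows pdx_pdx_commute: "pdx i (pdx j f) x y = pdx j (pdx i f) x y"
    and pdx_pdy_commute: "pdx i (pdy j f) x y = pdy j (pdx i f) x y"
    and pdy_pdy_commute: "pdy i (pdy j f) x y = pdy j (pdy i f) x y"
proof -
  let ?f = "\<lambda>(x, y). f x y"
  have smooth2: "smooth (Suc (Suc 0)) S f"
    using assms(2) by (simp add: numeral_2_eq_2)
  note smooth1 = smooth_pdx[OF \<open>open S\<close> smooth2] smooth_pdy[OF \<open>open S\<close> smooth2]
  have X: "dir_deriv u (\<lambda>(x, y). pdx n f x y) (x, y)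
    = dir_deriv u (dir_deriv (axis n 1, 0) ?f) (x, y)" for u n
    by (rule dir_deriv_cong[OF assms(1,3)]) (auto simp: pdx_eq_dir_deriv[OF smooth2])
  have Y: "dir_deriv u (\<lambda>(x, y). pdy n f x y) (x, y)
    = dir_deriv u (dir_deriv (0, axis n 1) ?f) (x, y)" for u n
    by (rule dir_deriv_cong[OF assms(1,3)]) (auto simp: pdy_eq_dir_deriv[OF smooth2])
  note comm = dir_deriv_commute[OF \<open>open S\<close> assms(2)[unfolded smooth_def] assms(3)]
  note eqs = pdx_eq_dir_deriv[OF smooth1(1) assms(3)] pdx_eq_dir_deriv[OF smooth1(2) assms(3)]
    pdy_eq_dir_deriv[OF smooth1(1) assms(3)] pdy_eq_dir_deriv[OF smooth1(2) assms(3)] X Y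
  show "pdx i (pdx j f) x y = pdx j (pdx i f) x y"
    "pdx i (pdy j f) x y = pdy j (pdx i f) x y"
    "pdy i (pdy j f) x y = pdy j (pdy i f) x y"
    unfolding eqs by (rule comm)+
qed

lemma
  assumes "smooth (Suc 0) S f" "smooth (Suc 0) S g" "(x, y) \<in> S"
  shows pdx_add: "pdx n (\<lambda>x y. f x y + g x y) x y = pdx n f x y + pdx n g x y"
    and pdy_add: "pdy n (\<lambda>x y. f x y + g x y) x y = pdy n f x y + pdy n g x y"
    and pdx_mult: "pdx n (\<lambda>x y. f x y * g x y) x y = f x y * pdx n g x y + pdx n f x y * g x y"
    and pdy_mult: "pdy n (\<lambda>x y. f x y * g x y) x y = f x y * pdy n g x y + pdy n f x y * g x y"
proof -
  note fx = smooth_differentiable_x[OF assms(1) assms(3)]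
    and fy = smooth_differentiable_y[OF assms(1) assms(3)]
    and gx = smooth_differentiable_x[OF assms(2) assms(3)]
    and gy = smooth_differentiable_y[OF assms(2) assms(3)]
  show "pdx n (\<lambda>x y. f x y + g x y) x y = pdx n f x y + pdx n g x y"
    "pdx n (\<lambda>x y. f x y * g x y) x y = f x y * pdx n g x y + pdx n f x y * g x y"
    unfolding pdx_def by (rule pd_add[OF fx gx] pd_mult[OF fx gx])+
  show "pdy n (\<lambda>x y. f x y + g x y) x y = pdy n f x y + pdy n g x y"
    "pdy n (\<lambda>x y. f x y * g x y) x y = f x y * pdy n g x y + pdy n f x y * g x y"
    unfolding pdy_def by (rule pd_add[OF fy gy] pd_mult[OF fy gy])+
qed

lemma
  assumes "smooth (Suc 0) S f" "(x, y) \<in> S"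
  shows pdx_minus: "pdx n (\<lambda>x y. - f x y) x y = - pdx n f x y"
    and pdy_minus: "pdy n (\<lambda>x y. - f x y) x y = - pdy n f x y"
  unfolding pdx_def pdy_def
  using pd_minus[OF smooth_differentiable_x[OF assms(1) assms(2)]]
    pd_minus[OF smooth_differentiable_y[OF assms(1) assms(2)]]
  by blast+

lemma pdy_diff:
  assumes "smooth (Suc 0) S f" "smooth (Suc 0) S g" "(x, y) \<in> S"
  shows "pdy n (\<lambda>x y. f x y - g x y) x y = pdy n f x y - pdy n g x y"
  using dir_deriv_add[OF smooth_differentiable_y[OF assms(1,3)]
      differentiable_minus[OF smooth_differentiable_y[OF assms(2,3)]], of "axis n 1"]
    dir_deriv_minus[OF smooth_differentiable_y[OF assms(2,3)], of "axis n 1"]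
  by (simp add: pdy_def pd_eq_dir_deriv)

lemma
  shows pdy_fibre_coordinate [simp]: "pdy n (\<lambda>x y. y $ i) x y = (if i = n then 1 else 0)"
    and pdx_base [simp]: "pdx n (\<lambda>x y. h x) x y = pd n h x"
    and pdy_base [simp]: "pdy n (\<lambda>x y. h x) x y = 0"
  by (simp_all add: pdx_def pdy_def)

section \<open>Fibre geometry of the Finsler metric\<close>

lemma matrix_inv_2:
  fixes A :: "real^2^2"
  assumes "det A \<noteq> 0"
  shows "matrix_inv A $ 1 $ 1 = A $ 2 $ 2 / det A" "matrix_inv A $ 1 $ 2 = - A $ 1 $ 2 / det A"
    "matrix_inv A $ 2 $ 1 = - A $ 2 $ 1 / det A" "matrix_inv A $ 2 $ 2 = A $ 1 $ 1 / det A"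
proof -
  have "invertible A" using assms by (simp add: invertible_det_nz)
  then have "matrix_inv A ** A = mat 1"
    unfolding invertible_def matrix_inv_def by (rule someI2_ex) blast
  then have eq: "matrix_inv A $ i $ 1 * A $ 1 $ j + matrix_inv A $ i $ 2 * A $ 2 $ j = (if i
    = j then 1 else 0)" for i j
    by (simp add: matrix_matrix_mult_def mat_def vec_eq_iff sum_2)
  have *: "p = (u * d - v * c) / D" "q = (v * a - u * b) / D"
    if "p * a + q * c = u" "p * b + q * d = v" "D = a * d - b * c" "D \<noteq> 0"
      for p q a b c d u v D :: real
  proof -
    have "p * D = u * d - v * c" "q * D = v * a - u * b"
      unfolding that(1,2)[symmetric] that(3) by (simp_all add: algebra_simps)
    then show "p = (u * d - v * c) / D" "q = (v * a - u * b) / D"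
      using that(4) by (simp_all add: nonzero_eq_divide_eq)
  qed
  note sol = *[OF eq eq det_2 assms]
  show "matrix_inv A $ 1 $ 1 = A $ 2 $ 2 / det A" "matrix_inv A $ 1 $ 2 = - A $ 1 $ 2 / det A"
    using sol[of 1] by simp_all
  show "matrix_inv A $ 2 $ 1 = - A $ 2 $ 1 / det A" "matrix_inv A $ 2 $ 2 = A $ 1 $ 1 / det A"
    using sol[of 2] by simp_all
qed

locale finsler_angle_space =
  fixes U :: "(real^2) set"
    and \<Omega> :: "((real^2) \<times> (real^2)) set"
    and F \<theta> :: "real^2 \<Rightarrow> real^2 \<Rightarrow> real"
    and b \<kappa> :: "real^2 \<Rightarrow> real^2"
  assumes open_U: "open U"
    and finsler: "finsler_metric U F"
    and b_smooth: "\<And>i. C_k_on 3 U (\<lambda>x. b x $ i)"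
    and conic: "conic_region U b \<Omega>"
    and angle: "angle_function U \<Omega> F b \<theta>"
    and \<kappa>_smooth: "\<And>n. C_k_on 2 U (\<lambda>x. \<kappa> x $ n)"
begin

lemma open_\<Omega>: "open \<Omega>"
  using conic by (simp add: conic_region_def)

lemma \<Omega>D: assumes "(x, y) \<in> \<Omega>" shows "x \<in> U" "y \<noteq> 0"
  using assms conic by (auto simp: conic_region_def)

lemma \<Omega>_subset: "\<Omega> \<subseteq> U \<times> UNIV"
  using \<Omega>D by auto

lemma b_in_\<Omega>: "x \<in> U \<Longrightarrow> (x, b x) \<in> \<Omega>"
  using conic by (simp add: conic_region_def)

lemma F_pos: "(x, y) \<in> \<Omega> \<Longrightarrow> F x y > 0"
  using finsler \<Omega>D by (auto simp: finsler_metric_def)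

lemma F_homogeneous: "(x, y) \<in> \<Omega> \<Longrightarrow> t > 0 \<Longrightarrow> F x (t *\<^sub>R y) = t * F x y"
  using finsler \<Omega>D by (auto simp: finsler_metric_def)

lemma F_smooth: "smooth 5 \<Omega> F"
proof -
  have "\<Omega> \<subseteq> U \<times> (UNIV - {0})"
    using \<Omega>D by auto
  then show ?thesis
    using finsler unfolding smooth_def finsler_metric_def by (blast intro: C_k_on_subset)
qed

lemma F_y_smooth: "smooth 4 \<Omega> (pdy i F)"
  using smooth_pdy[OF open_\<Omega>, of 4 F] F_smooth by simp

lemma F_x_smooth: "smooth 4 \<Omega> (pdx i F)"
  using smooth_pdx[OF open_\<Omega>, of 4 F] F_smooth by simp

text \<open>
  Euler's theorem: the derivative at \<open>s = 1\<close> of \<open>F (x, s y) = s F (x, y)\<close>.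
\<close>

lemma euler:
  assumes "(x, y) \<in> \<Omega>"
  shows "y $ 1 * pdy 1 F x y + y $ 2 * pdy 2 F x y = F x y"
proof -
  have diff: "F x differentiable (at y)"
    using smooth_differentiable_y[of 4 \<Omega> F x y] F_smooth assms by simp
  have "((\<lambda>s. F x (0 + s *\<^sub>R y)) has_real_derivative dir_deriv y (F x) (0 + 1 *\<^sub>R y)) (at 1)"
    by (rule DERIV_line) (use diff in simp)
  moreover have "((\<lambda>s. F x (0 + s *\<^sub>R y)) has_real_derivative F x y) (at 1)"
  proof (rule has_field_derivative_transform_within_open[of "\<lambda>s. s * F x y" _ _ "{0<..}"])
    show "((\<lambda>s. s * F x y) has_real_derivative F x y) (at 1)"
      by (auto intro!: derivative_eq_intros)
  qed (use F_homogeneous assms in auto)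
  ultimately have "dir_deriv y (F x) y = F x y"
    using DERIV_unique by force
  then show ?thesis
    using dir_deriv_eq_sum_pd[OF diff] by (simp add: sum_2 pdy_def)
qed

lemma euler_derivative:
  assumes "(x, y) \<in> \<Omega>"
  shows "y $ 1 * pdy j (pdy 1 F) x y + y $ 2 * pdy j (pdy 2 F) x y = 0"
proof -
  have s: "smooth (Suc 0) \<Omega> (pdy i F)" for i
    by (rule smooth_le[OF F_y_smooth]) simp
  have "pdy j (\<lambda>x y. y $ 1 * pdy 1 F x y + y $ 2 * pdy 2 F x y) x y = pdy j F x y"
    by (rule pdy_cong[OF open_\<Omega> assms]) (rule euler)
  then show ?thesis
    using exhaust_2[of j]
    by (auto simp: s assms open_\<Omega> smooth_mult pdy_add[where S = \<Omega>] pdy_mult[where S = \<Omega>])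
qed

lemma Y_smooth: "smooth 4 \<Omega> (y_cov F i)"
  unfolding y_cov_def
  by (intro smooth_mult open_\<Omega> F_y_smooth smooth_le[OF F_smooth]) simp

lemma g_eq_pdy: "g_cov F i j = pdy j (y_cov F i)"
  by (simp add: fun_eq_iff g_cov_def g_mat_def)

lemma g_smooth: "smooth 3 \<Omega> (g_cov F i j)"
  unfolding g_eq_pdy using smooth_pdy[OF open_\<Omega>, of 3] Y_smooth by simp

text \<open>
  Since \<open>g\<close> is defined as the derivative of \<open>y_cov\<close>, its symmetry is not apparent; it shows in
  this form, by symmetry of the second derivatives of \<open>F\<close>.
\<close>

lemma g_eq:
  assumes "(x, y) \<in> \<Omega>"
  shows "g_cov F i j x y = F x y * pdy j (pdy i F) x y + pdy j F x y * pdy i F x y"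
  unfolding g_eq_pdy y_cov_def
  by (rule pdy_mult[where S = \<Omega>])
    (use assms smooth_le[OF F_y_smooth] smooth_le[OF F_smooth] in auto)

lemma g_symmetric: "(x, y) \<in> \<Omega> \<Longrightarrow> g_cov F i j x y = g_cov F j i x y"
  by (simp add: g_eq pdy_pdy_commute[OF open_\<Omega> smooth_le[OF F_smooth], of _ _ i j])

lemma g_y:
  assumes "(x, y) \<in> \<Omega>"
  shows "y $ 1 * g_cov F 1 i x y + y $ 2 * g_cov F 2 i x y = y_cov F i x y"
proof -
  have "y $ 1 * g_cov F 1 i x y + y $ 2 * g_cov F 2 i x y
    = F x y * (y $ 1 * pdy i (pdy 1 F) x y + y $ 2 * pdy i (pdy 2 F) x y)
      + pdy i F x y * (y $ 1 * pdy 1 F x y + y $ 2 * pdy 2 F x y)"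
    by (simp add: g_eq[OF assms] algebra_simps)
  also have "\<dots> = y_cov F i x y"
    by (simp add: euler_derivative[OF assms] euler[OF assms] y_cov_def)
  finally show ?thesis .
qed

lemma Y_y: "(x, y) \<in> \<Omega> \<Longrightarrow> y $ 1 * y_cov F 1 x y + y $ 2 * y_cov F 2 x y = (F x y)\<^sup>2"
  using euler[of x y] by (simp add: y_cov_def power2_eq_square algebra_simps flip: distrib_left)

lemma det_g: "det (g_mat F x y)
  = g_cov F 1 1 x y * g_cov F 2 2 x y - g_cov F 1 2 x y * g_cov F 2 1 x y"
  by (simp add: det_2 g_cov_def)

lemma det_g_pos:
  assumes "(x, y) \<in> \<Omega>"
  shows "det (g_mat F x y) > 0"
proof -
  have pos: "(\<Sum>i\<in>UNIV. \<Sum>j\<in>UNIV. g_cov F i j x y * v $ i * v $ j) > 0" if "v \<noteq> 0" for v :: "real^2"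
    using finsler \<Omega>D[OF assms] that by (auto simp: finsler_metric_def)
  have g11: "g_cov F 1 1 x y > 0"
    using pos[of "vector [1, 0]"] by (auto simp: sum_2 vec_eq_iff forall_2)
  \<comment> \<open>the value of the form at \<open>(- g\<^sub>1\<^sub>2, g\<^sub>1\<^sub>1)\<close> is \<open>g\<^sub>1\<^sub>1 det g\<close>\<close>
  have "g_cov F 1 1 x y * det (g_mat F x y) > 0"
    using pos[of "vector [- g_cov F 1 2 x y, g_cov F 1 1 x y]"] g11
    by (auto simp: sum_2 vec_eq_iff forall_2 det_g g_symmetric[OF assms, of 2 1] algebra_simps)
  with g11 show ?thesis
    by (simp add: zero_less_mult_iff)
qed

definition vol :: "real^2 \<Rightarrow> real^2 \<Rightarrow> real" where
  "vol x y = sqrt (det (g_mat F x y))"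

lemma vol_pos: "(x, y) \<in> \<Omega> \<Longrightarrow> vol x y > 0"
  using det_g_pos by (simp add: vol_def)

lemma vol_square: "(x, y) \<in> \<Omega> \<Longrightarrow> vol x y * vol x y = det (g_mat F x y)"
  using det_g_pos[of x y] by (simp add: vol_def)

lemma vol_smooth: "smooth 3 \<Omega> vol"
  unfolding vol_def
proof (rule smooth_sqrt[OF open_\<Omega> _ det_g_pos])
  show "smooth 3 \<Omega> (\<lambda>x y. det (g_mat F x y))"
    unfolding det_g by (intro smooth_diff smooth_mult open_\<Omega> g_smooth)
qed

lemma m_cov_eq:
  shows "m_cov F 1 x y = - vol x y * (y $ 2 / F x y)" "m_cov F 2 x y = vol x y * (y $ 1 / F x y)"
  by (simp_all add: m_cov_def eps_def perm_symb_def sum_2 vol_def l_con_def)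

text \<open>
  The vertical vector field \<open>F m\<^sup>k \<partial>/\<partial>y\<^sup>k\<close>. It annihilates \<open>F\<close> and takes the value 1 on \<open>\<theta>\<close>
  (lemmas \<open>rot_F\<close> and \<open>rot_\<theta>\<close>), so it is the field \<open>\<partial>/\<partial>\<theta>\<close> of the polar coordinates \<open>(F, \<theta>)\<close> of
  the tangent plane: the infinitesimal rotation along the indicatrix.
\<close>

definition rot :: "2 \<Rightarrow> real^2 \<Rightarrow> real^2 \<Rightarrow> real" where
  "rot k x y = F x y * m_con F k x y"

lemma g_con_eq:
  assumes "(x, y) \<in> \<Omega>"
  shows "g_con F 1 1 x y = g_cov F 2 2 x y / (vol x y * vol x y)"
    "g_con F 1 2 x y = - g_cov F 1 2 x y / (vol x y * vol x y)"
    "g_con F 2 1 x y = - g_cov F 2 1 x y / (vol x y * vol x y)"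
    "g_con F 2 2 x y = g_cov F 1 1 x y / (vol x y * vol x y)"
  using matrix_inv_2[of "g_mat F x y"] det_g_pos[OF assms]
  by (simp_all add: g_con_def g_cov_def vol_square[OF assms])

lemma g_cov_g_con:
  assumes "(x, y) \<in> \<Omega>"
  shows "g_cov F i 1 x y * g_con F 1 j x y + g_cov F i 2 x y * g_con F 2 j x y = (if i
    = j then 1 else 0)"
proof -
  have "g_cov F 1 1 x y * g_cov F 2 2 x y - g_cov F 1 2 x y * g_cov F 2 1 x y = vol x y * vol x y"
    "vol x y * vol x y \<noteq> 0"
    using vol_square[OF assms] vol_pos[OF assms] by (auto simp: det_g)
  then show ?thesis
    using exhaust_2[of i] exhaust_2[of j]
    by (auto simp: g_con_eq[OF assms] mult.commute simp flip: diff_divide_distrib simp del: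
      mult_eq_0_iff)
qed

text \<open>
  Raising the index of \<open>m\<close> in dimension two amounts to rotating \<open>y_cov\<close>, because the inverse of
  \<open>g\<close> is its adjugate over its determinant. The formula contains neither an inverse matrix nor a
  quotient by \<open>F\<close>, hence it is the one to differentiate.
\<close>

lemma rot_eq:
  assumes "(x, y) \<in> \<Omega>"
  shows "rot 1 x y = - y_cov F 2 x y / vol x y" "rot 2 x y = y_cov F 1 x y / vol x y"
  using vol_pos[OF assms] F_pos[OF assms]
  by (simp_all add: rot_def m_con_def sum_2 m_cov_eq g_con_eq[OF assms] g_y[OF assms, symmetric]
      g_symmetric[OF assms, of 2 1] field_simps)

lemma rot_smooth: "smooth 3 \<Omega> (rot k)"
proof -
  have "smooth 3 \<Omega> (\<lambda>x y. - y_cov F 2 x y / vol x y)" "smooth 3 \<Omega> (\<lambda>x y. y_cov F 1 x y / vol x y)"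
    using vol_pos by (auto intro!: smooth_divide smooth_minus open_\<Omega> vol_smooth smooth_le[OF
      Y_smooth] less_imp_neq[THEN not_sym])
  note formula = this
  have "smooth 3 \<Omega> (rot 1)"
    by (rule smooth_cong[OF open_\<Omega> _ formula(1)]) (simp add: rot_eq)
  moreover have "smooth 3 \<Omega> (rot 2)"
    by (rule smooth_cong[OF open_\<Omega> _ formula(2)]) (simp add: rot_eq)
  ultimately show ?thesis
    using exhaust_2[of k] by auto
qed

lemma \<theta>_smooth: "smooth 3 \<Omega> \<theta>"
  using angle by (simp add: angle_function_def smooth_def)

lemma \<theta>_y: "(x, y) \<in> \<Omega> \<Longrightarrow> pdy n \<theta> x y = m_cov F n x y / F x y"
  using angle F_pos[of x y] by (auto simp: angle_function_def field_simps)

lemma rot_F: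
  assumes "(x, y) \<in> \<Omega>"
  shows "rot 1 x y * pdy 1 F x y + rot 2 x y * pdy 2 F x y = 0"
  by (simp add: rot_eq[OF assms] y_cov_def)

lemma rot_\<theta>:
  assumes "(x, y) \<in> \<Omega>"
  shows "rot 1 x y * pdy 1 \<theta> x y + rot 2 x y * pdy 2 \<theta> x y = 1"
proof -
  have "rot 1 x y * pdy 1 \<theta> x y + rot 2 x y * pdy 2 \<theta> x y
      = (y $ 1 * y_cov F 1 x y + y $ 2 * y_cov F 2 x y) / (F x y)\<^sup>2"
    using vol_pos[OF assms] F_pos[OF assms]
    by (simp add: rot_eq[OF assms] \<theta>_y[OF assms] m_cov_eq power2_eq_square field_simps)
  then show ?thesis
    using F_pos[OF assms] by (simp add: Y_y[OF assms])
qed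

section \<open>The angle-preserving connection\<close>

abbreviation "N \<equiv> N_coef F \<theta> \<kappa>"
abbreviation "\<delta> \<equiv> d_op F \<theta> \<kappa>"

lemma N_eq: "N k n x y = - (y $ k / F x y) * pdx n F x y - rot k x y * (pdx n \<theta> x y - \<kappa> x $ n)"
  by (simp add: N_coef_def l_con_def rot_def)

lemma N_smooth: "smooth 2 \<Omega> (N k n)"
proof -
  have 1: "smooth 2 \<Omega> (\<lambda>x y. y $ k / F x y)"
    using F_pos by (intro smooth_divide open_\<Omega> smooth_le[OF F_smooth])
      (auto simp: less_imp_neq[THEN not_sym])
  have 2: "smooth 2 \<Omega> (pdx n \<theta>)"
    using smooth_pdx[OF open_\<Omega>, of 2 \<theta>] \<theta>_smooth by simp
  have 3: "smooth 2 \<Omega> (\<lambda>x y. \<kappa> x $ n)"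
    by (rule smooth_base[OF open_\<Omega> \<kappa>_smooth \<Omega>_subset])
  show ?thesis
    unfolding N_eq
    by (intro smooth_diff smooth_mult smooth_minus open_\<Omega> 1 2 3 smooth_le[OF F_x_smooth]
      smooth_le[OF rot_smooth]) auto
qed

lemma horizontal_eq: "\<delta> n f x y = pdx n f x y + (N 1 n x y * pdy 1 f x y + N 2 n x y * pdy 2 f x y)"
  by (simp add: d_op_def sum_2)

text \<open>
  The connection is built so that \<open>F\<close> is horizontally constant and \<open>\<theta>\<close> has horizontal derivative
  \<open>\<kappa>\<close>: the first term of \<open>N\<close> cancels \<open>\<partial>F/\<partial>x\<close> by Euler's theorem and the second one leaves \<open>F\<close>
  alone, being a multiple of \<open>rot\<close>. In the coordinates \<open>(x, F, \<theta>)\<close> the operators are therefore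
  \<open>\<delta>\<^sub>n = \<partial>/\<partial>x\<^sup>n + \<kappa>\<^sub>n \<partial>/\<partial>\<theta>\<close>.
\<close>

lemma horizontal_F:
  assumes "(x, y) \<in> \<Omega>"
  shows "\<delta> n F x y = 0"
proof -
  have "\<delta> n F x y = pdx n F x y
      - pdx n F x y / F x y * (y $ 1 * pdy 1 F x y + y $ 2 * pdy 2 F x y)
      - (pdx n \<theta> x y - \<kappa> x $ n) * (rot 1 x y * pdy 1 F x y + rot 2 x y * pdy 2 F x y)"
    by (simp add: horizontal_eq N_eq algebra_simps)
  then show ?thesis
    using F_pos[OF assms] by (simp add: rot_F[OF assms] euler[OF assms])
qed

lemma horizontal_\<theta>:
  assumes "(x, y) \<in> \<Omega>"
  shows "\<delta> n \<theta> x y = \<kappa> x $ n"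
proof -
  have "y $ 1 * pdy 1 \<theta> x y + y $ 2 * pdy 2 \<theta> x y = 0"
    using F_pos[OF assms] by (simp add: \<theta>_y[OF assms] m_cov_eq)
  moreover have "\<delta> n \<theta> x y = pdx n \<theta> x y
      - pdx n F x y / F x y * (y $ 1 * pdy 1 \<theta> x y + y $ 2 * pdy 2 \<theta> x y)
      - (pdx n \<theta> x y - \<kappa> x $ n) * (rot 1 x y * pdy 1 \<theta> x y + rot 2 x y * pdy 2 \<theta> x y)"
    by (simp add: horizontal_eq N_eq algebra_simps)
  ultimately show ?thesis
    by (simp add: rot_\<theta>[OF assms])
qed

lemma horizontal_cong:
  "(x, y) \<in> \<Omega> \<Longrightarrow> (\<And>x y. (x, y) \<in> \<Omega> \<Longrightarrow> f x y = g x y) \<Longrightarrow> \<delta> n f x y = \<delta> n g x y"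
  unfolding horizontal_eq by (simp add: pdx_cong[OF open_\<Omega>, of x y f g] pdy_cong[OF open_\<Omega>, of x y
    f g])

lemma
  assumes "smooth 2 \<Omega> f"
  shows smooth1_of_2: "smooth (Suc 0) \<Omega> f"
    and smooth1_pdx: "smooth (Suc 0) \<Omega> (pdx i f)"
    and smooth1_pdy: "smooth (Suc 0) \<Omega> (pdy i f)"
  using smooth_le[OF assms] smooth_pdx[OF open_\<Omega>, of 1 f] smooth_pdy[OF open_\<Omega>, of 1 f] assms
  by (simp_all add: numeral_2_eq_2)

lemmas smooth1 = smooth1_of_2 smooth1_pdx smooth1_pdy smooth_mult[OF open_\<Omega>] smooth_add[OF open_\<Omega>]
lemmas Leibniz = pdx_add[where S = \<Omega>] pdy_add[where S = \<Omega>] pdx_mult[where S = \<Omega>] pdy_mult[where S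
  = \<Omega>]

lemma horizontal_twice:
  assumes "smooth 2 \<Omega> f" "(x, y) \<in> \<Omega>"
  shows "\<delta> i (\<delta> j f) x y = \<delta> i (pdx j f) x y
      + (\<delta> i (N 1 j) x y * pdy 1 f x y + \<delta> i (N 2 j) x y * pdy 2 f x y)
      + (N 1 j x y * \<delta> i (pdy 1 f) x y + N 2 j x y * \<delta> i (pdy 2 f) x y)"
  unfolding horizontal_eq[abs_def]
  by (simp add: Leibniz smooth1 assms N_smooth) (simp add: algebra_simps)

text \<open>
  The commutator of two horizontal derivations is vertical, and \<open>M\<close> is its vector of components:
  all second derivatives of \<open>f\<close> cancel by symmetry.
\<close>

lemma horizontal_commutator:
  assumes "smooth 2 \<Omega> f" "(x, y) \<in> \<Omega>"
  shows "\<delta> i (\<delta> j f) x y - \<delta> j (\<delta> i f) x y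
    = curv_M F \<theta> \<kappa> 1 i j x y * pdy 1 f x y + curv_M F \<theta> \<kappa> 2 i j x y * pdy 2 f x y"
proof -
  note commute = pdx_pdx_commute[OF open_\<Omega> assms, of i j] pdx_pdy_commute[OF open_\<Omega> assms]
    pdy_pdy_commute[OF open_\<Omega> assms, of 2 1]
  show ?thesis
    unfolding horizontal_twice[OF assms] curv_M_def horizontal_eq[of _ "pdx _ f"] horizontal_eq[of
      _ "pdy _ f"] commute
    by (simp add: algebra_simps)
qed

definition d\<kappa> :: "2 \<Rightarrow> 2 \<Rightarrow> real^2 \<Rightarrow> real" where
  "d\<kappa> i j x = pd i (\<lambda>x. \<kappa> x $ j) x - pd j (\<lambda>x. \<kappa> x $ i) x"

text \<open>
  A vertical vector is determined by its values on \<open>F\<close> and \<open>\<theta>\<close>. As \<open>\<delta>\<^sub>j F = 0\<close> and \<open>\<delta>\<^sub>j \<theta> = \<kappa>\<^sub>j\<close>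
  hold identically, the commutator \<open>M\<close> has the values 0 and \<open>d\<kappa>\<close> on them, which are those of
  \<open>d\<kappa> \<cdot> rot\<close>.
\<close>

lemma curv_M_eq:
  assumes "(x, y) \<in> \<Omega>"
  shows "curv_M F \<theta> \<kappa> k i j x y = d\<kappa> i j x * rot k x y"
proof -
  let ?M = "\<lambda>k. curv_M F \<theta> \<kappa> k i j x y"
  have "\<delta> i (\<delta> j F) x y = \<delta> i (\<lambda>x y. 0) x y" for i j
    by (rule horizontal_cong[OF assms]) (rule horizontal_F)
  then have "?M 1 * pdy 1 F x y + ?M 2 * pdy 2 F x y = 0"
    using horizontal_commutator[OF smooth_le[OF F_smooth] assms, of i j] by
      (simp add: horizontal_eq)
  moreover have "\<delta> i (\<delta> j \<theta>) x y = \<delta> i (\<lambda>x y. \<kappa> x $ j) x y" for i j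
    by (rule horizontal_cong[OF assms]) (rule horizontal_\<theta>)
  then have "?M 1 * pdy 1 \<theta> x y + ?M 2 * pdy 2 \<theta> x y = d\<kappa> i j x"
    using horizontal_commutator[OF smooth_le[OF \<theta>_smooth] assms, of i j] by
      (simp add: horizontal_eq d\<kappa>_def)
  ultimately have M\<theta>: "vol x y * (?M 2 * y $ 1 - ?M 1 * y $ 2) = d\<kappa> i j x * (F x y)\<^sup>2"
    and "?M 1 * pdy 1 F x y + ?M 2 * pdy 2 F x y = 0"
    using F_pos[OF assms] by (simp_all add: \<theta>_y[OF assms] m_cov_eq field_simps power2_eq_square)
  then have MY: "?M 1 * y_cov F 1 x y = - (?M 2 * y_cov F 2 x y)"
    unfolding y_cov_def by algebra
  have F2: "(F x y)\<^sup>2 \<noteq> 0"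
    using F_pos[OF assms] by simp
  have "(F x y)\<^sup>2 * (vol x y * ?M 1) = (F x y)\<^sup>2 * (- d\<kappa> i j x * y_cov F 2 x y)"
    "(F x y)\<^sup>2 * (vol x y * ?M 2) = (F x y)\<^sup>2 * (d\<kappa> i j x * y_cov F 1 x y)"
    using M\<theta> MY Y_y[OF assms] by algebra+
  then have "vol x y * ?M 1 = - d\<kappa> i j x * y_cov F 2 x y" "vol x y * ?M 2
    = d\<kappa> i j x * y_cov F 1 x y"
    by (simp_all only: mult_left_cancel[OF F2])
  then show ?thesis
    using exhaust_2[of k] vol_pos[OF assms] by (auto simp: rot_eq[OF assms] field_simps)
qed

lemma pdy_horizontal:
  assumes "smooth 2 \<Omega> f" "(x, y) \<in> \<Omega>"
  shows "pdy k (\<delta> i f) x y = \<delta> i (pdy k f) x y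
    + (pdy k (N 1 i) x y * pdy 1 f x y + pdy k (N 2 i) x y * pdy 2 f x y)"
proof -
  have "pdy k (\<delta> i f) x y = pdy k (pdx i f) x y
    + (pdy k (N 1 i) x y * pdy 1 f x y + pdy k (N 2 i) x y * pdy 2 f x y)
    + (N 1 i x y * pdy k (pdy 1 f) x y + N 2 i x y * pdy k (pdy 2 f) x y)"
    unfolding horizontal_eq[abs_def]
    by (simp add: Leibniz smooth1 assms N_smooth)
  then show ?thesis
    by (simp add: horizontal_eq pdx_pdy_commute[OF open_\<Omega> assms] pdy_pdy_commute[OF open_\<Omega> assms,
      of _ k])
qed

lemma horizontal_minus:
  assumes "smooth (Suc 0) \<Omega> f" "(x, y) \<in> \<Omega>"
  shows "\<delta> i (\<lambda>x y. - f x y) x y = - \<delta> i f x y"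
  by (simp add: horizontal_eq pdx_minus[OF assms] pdy_minus[OF assms])

lemma smooth1_horizontal: "smooth 2 \<Omega> f \<Longrightarrow> smooth (Suc 0) \<Omega> (\<delta> i f)"
  unfolding horizontal_eq[abs_def] by (simp add: smooth1 N_smooth)

text \<open>
  \<open>D\<close> is the negative vertical derivative of \<open>N\<close>. Pulling a vertical derivative through \<open>\<delta>\<^sub>i\<close>
  costs a term quadratic in the derivatives of \<open>N\<close>, and these terms are exactly the quadratic
  terms of \<open>E\<close>.
\<close>

lemma curv_E_eq:
  assumes "(x, y) \<in> \<Omega>"
  shows "curv_E F \<theta> \<kappa> k n i j x y = - pdy k (curv_M F \<theta> \<kappa> n i j) x y"
proof -
  have "pdy k (curv_M F \<theta> \<kappa> n i j) x y = pdy k (\<delta> i (N n j)) x y - pdy k (\<delta> j (N n i)) x y"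
    using pdy_diff[OF smooth1_horizontal[OF N_smooth] smooth1_horizontal[OF N_smooth] assms]
    by (simp add: curv_M_def[abs_def])
  moreover have "\<delta> i (\<lambda>x y. D_coef F \<theta> \<kappa> n j k x y) x y = - \<delta> i (pdy k (N n j)) x y" for i j
    unfolding D_coef_def by (rule horizontal_minus[OF smooth1_pdy[OF N_smooth] assms])
  ultimately show ?thesis
    by (simp add: curv_E_def pdy_horizontal[OF N_smooth assms] sum_2)
      (simp add: D_coef_def algebra_simps)
qed

text \<open>
  \<open>C\<^sub>n\<^sub>i\<^sub>k y\<^sup>n = 0\<close>: differentiating \<open>g\<^sub>n\<^sub>i y\<^sup>n = y\<^sub>i\<close> produces \<open>g\<^sub>i\<^sub>k\<close> on both sides.
\<close>

lemma g_y_derivative: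
  assumes "(x, y) \<in> \<Omega>"
  shows "y $ 1 * pdy k (g_cov F 1 i) x y + y $ 2 * pdy k (g_cov F 2 i) x y = 0"
proof -
  have s: "smooth (Suc 0) \<Omega> (g_cov F i j)" for i j
    by (rule smooth_le[OF g_smooth]) simp
  have "pdy k (\<lambda>x y. y $ 1 * g_cov F 1 i x y + y $ 2 * g_cov F 2 i x y) x y = g_cov F i k x y"
    unfolding g_eq_pdy[of i k] by (rule pdy_cong[OF open_\<Omega> assms]) (rule g_y)
  then show ?thesis
    using exhaust_2[of k] g_symmetric[OF assms, of i k]
    by (auto simp: s assms smooth1 Leibniz)
qed

lemma vol_derivative:
  assumes "(x, y) \<in> \<Omega>"
  shows "2 * vol x y * pdy k vol x y = pdy k (g_cov F 1 1) x y * g_cov F 2 2 x y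
    + g_cov F 1 1 x y * pdy k (g_cov F 2 2) x y - 2 * g_cov F 1 2 x y * pdy k (g_cov F 1 2) x y"
proof -
  have s: "smooth (Suc 0) \<Omega> (g_cov F i j)" "smooth (Suc 0) \<Omega> vol" for i j
    by (rule smooth_le[OF g_smooth] smooth_le[OF vol_smooth]; simp)+
  have "pdy k (\<lambda>x y. vol x y * vol x y + g_cov F 1 2 x y * g_cov F 1 2 x y) x y
    = pdy k (\<lambda>x y. g_cov F 1 1 x y * g_cov F 2 2 x y) x y"
    by (rule pdy_cong[OF open_\<Omega> assms]) (simp add: vol_square det_g g_symmetric[of _ _ 2 1])
  then show ?thesis
    by (simp add: s assms smooth1 Leibniz algebra_simps)
qed

lemma rot_derivative:
  assumes "(x, y) \<in> \<Omega>"
  shows "vol x y * pdy k (rot 1) x y + pdy k vol x y * rot 1 x y = - g_cov F 2 k x y"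
    "vol x y * pdy k (rot 2) x y + pdy k vol x y * rot 2 x y = g_cov F 1 k x y"
proof -
  have s: "smooth (Suc 0) \<Omega> (rot i)" "smooth (Suc 0) \<Omega> vol" "smooth (Suc 0) \<Omega> (y_cov F i)" for i
    by (rule smooth_le[OF rot_smooth] smooth_le[OF vol_smooth] smooth_le[OF Y_smooth]; simp)+
  have "pdy k (\<lambda>x y. vol x y * rot 1 x y) x y = pdy k (\<lambda>x y. - y_cov F 2 x y) x y"
    by (rule pdy_cong[OF open_\<Omega> assms])
      (use vol_pos in \<open>auto simp: rot_eq less_imp_neq[THEN not_sym]\<close>)
  then show "vol x y * pdy k (rot 1) x y + pdy k vol x y * rot 1 x y = - g_cov F 2 k x y"
    by (simp add: s assms smooth1 Leibniz pdy_minus[where S = \<Omega>] g_eq_pdy)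
  have "pdy k (\<lambda>x y. vol x y * rot 2 x y) x y = pdy k (\<lambda>x y. y_cov F 1 x y) x y"
    by (rule pdy_cong[OF open_\<Omega> assms])
      (use vol_pos in \<open>auto simp: rot_eq less_imp_neq[THEN not_sym]\<close>)
  then show "vol x y * pdy k (rot 2) x y + pdy k vol x y * rot 2 x y = g_cov F 1 k x y"
    by (simp add: s assms smooth1 Leibniz g_eq_pdy)
qed

text \<open>
  The Cartan covariant vertical derivative of the rotation field is minus the area form.
  Differentiating \<open>vol \<cdot> rot\<close>, which is \<open>y_cov\<close> up to a rotation of the plane, gives the area
  form and a term with the derivative of \<open>vol\<close>. That term is cancelled by the Cartan tensor: in
  dimension two \<open>C y = 0\<close> forces the derivative of \<open>g\<^sub>i\<^sub>j\<close> in a fixed direction \<open>k\<close> to be a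
  multiple \<open>c\<close> of the square of the covector \<open>(y\<^sup>2, - y\<^sup>1)\<close>, and the derivative of \<open>det g\<close> is
  governed by the same \<open>c\<close>.
\<close>

lemma rot_vertical_derivative:
  assumes "(x, y) \<in> \<Omega>"
  shows "(\<Sum>m\<in>UNIV. g_cov F n m x y * pdy k (rot m) x y) + (\<Sum>h\<in>UNIV. rot h x y * C_cov F n h k x y)
    = - vol x y * perm_symb n k"
proof -
  let ?g = "\<lambda>i j. g_cov F i j x y" and ?V = "\<lambda>i. rot i x y" and ?dV = "\<lambda>i. pdy k (rot i) x y"
  define s where "s = vol x y"
  define ds where "ds = pdy k vol x y"
  define P where "P = pdy k (g_cov F 1 1) x y"
  define Q where "Q = pdy k (g_cov F 1 2) x y"
  define R where "R = pdy k (g_cov F 2 2) x y"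
  \<comment> \<open>\<open>c\<close> is found from the trace of the matrix with entries \<open>P, Q, Q, R\<close>\<close>
  define c where "c = (P + R) / ((y $ 1)\<^sup>2 + (y $ 2)\<^sup>2)"
  have sym: "?g 2 1 = ?g 1 2"
    by (rule g_symmetric[OF assms])
  have "pdy k (g_cov F 2 1) x y = Q"
    unfolding Q_def by (rule pdy_cong[OF open_\<Omega> assms]) (rule g_symmetric)
  note dg = this P_def[symmetric] Q_def[symmetric] R_def[symmetric]
  have s: "s \<noteq> 0" "s * s = ?g 1 1 * ?g 2 2 - ?g 1 2 * ?g 1 2"
    using vol_pos[OF assms] vol_square[OF assms] by (simp_all add: s_def det_g sym)
  have ne: "(y $ 1)\<^sup>2 + (y $ 2)\<^sup>2 \<noteq> 0"
    using \<Omega>D(2)[OF assms] by (auto simp: sum_power2_eq_zero_iff vec_eq_iff forall_2)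
  have PQR: "y $ 1 * P + y $ 2 * Q = 0" "y $ 1 * Q + y $ 2 * R = 0"
    using g_y_derivative[OF assms, of k 1] g_y_derivative[OF assms, of k 2] by (simp_all add: dg)
  have c: "P = c * (y $ 2)\<^sup>2" "Q = - c * (y $ 1 * y $ 2)" "R = c * (y $ 1)\<^sup>2"
  proof -
    have "((y $ 1)\<^sup>2 + (y $ 2)\<^sup>2) * c = P + R"
      using ne by (simp add: c_def)
    with PQR have "((y $ 1)\<^sup>2 + (y $ 2)\<^sup>2) * P = ((y $ 1)\<^sup>2 + (y $ 2)\<^sup>2) * (c * (y $ 2)\<^sup>2)"
      "((y $ 1)\<^sup>2 + (y $ 2)\<^sup>2) * Q = ((y $ 1)\<^sup>2 + (y $ 2)\<^sup>2) * (- c * (y $ 1 * y $ 2))"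
      "((y $ 1)\<^sup>2 + (y $ 2)\<^sup>2) * R = ((y $ 1)\<^sup>2 + (y $ 2)\<^sup>2) * (c * (y $ 1)\<^sup>2)"
      by algebra+
    then show "P = c * (y $ 2)\<^sup>2" "Q = - c * (y $ 1 * y $ 2)" "R = c * (y $ 1)\<^sup>2"
      by (simp_all only: mult_left_cancel[OF ne])
  qed
  have Y: "y $ 1 * ?g 1 1 + y $ 2 * ?g 1 2 = y_cov F 1 x y" "y $ 1 * ?g 1 2 + y $ 2 * ?g 2 2
    = y_cov F 2 x y"
    using g_y[OF assms, of 1] g_y[OF assms, of 2] by (simp_all add: sym)
  have V: "s * ?V 1 = - y_cov F 2 x y" "s * ?V 2 = y_cov F 1 x y"
    using s by (simp_all add: rot_eq[OF assms] s_def)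
  have dV: "s * ?dV 1 + ds * ?V 1 = - ?g 2 k" "s * ?dV 2 + ds * ?V 2 = ?g 1 k"
    using rot_derivative[OF assms] by (simp_all add: s_def ds_def)
  have ds: "2 * s * ds = c * (y $ 1 * y_cov F 1 x y + y $ 2 * y_cov F 2 x y)"
    using vol_derivative[OF assms, of k, folded s_def ds_def, unfolded dg] c Y by algebra
  \<comment> \<open>multiplied by \<open>s\<close>, the components of \<open>rot\<close> become those of \<open>y_cov\<close>; so prove and cancel\<close>
  have "s * (?g 1 1 * ?V 1 + ?g 1 2 * ?V 2) = s * (- s * y $ 2)"
    "s * (?g 1 2 * ?V 1 + ?g 2 2 * ?V 2) = s * (s * y $ 1)"
    using V Y s(2) by algebra+
  then have gV: "?g 1 1 * ?V 1 + ?g 1 2 * ?V 2 = - s * y $ 2" "?g 1 2 * ?V 1 + ?g 2 2 * ?V 2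
    = s * y $ 1"
    by (simp_all only: mult_left_cancel[OF s(1)])
  have "s * (?V 1 * P + ?V 2 * Q) = s * (- 2 * ds * y $ 2)"
    "s * (?V 1 * Q + ?V 2 * R) = s * (2 * ds * y $ 1)"
    using V ds c by algebra+
  then have CV: "?V 1 * P + ?V 2 * Q = - 2 * ds * y $ 2" "?V 1 * Q + ?V 2 * R = 2 * ds * y $ 1"
    by (simp_all only: mult_left_cancel[OF s(1)])
  have "s * (?g 1 1 * ?dV 1 + ?g 1 2 * ?dV 2 + (?V 1 * P + ?V 2 * Q) / 2)
    = ?g 1 2 * ?g 1 k - ?g 1 1 * ?g 2 k"
    "s * (?g 1 2 * ?dV 1 + ?g 2 2 * ?dV 2 + (?V 1 * Q + ?V 2 * R) / 2)
      = ?g 2 2 * ?g 1 k - ?g 1 2 * ?g 2 k"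
    unfolding CV using dV gV by simp_all algebra+
  moreover have "?g 1 2 * ?g 1 k - ?g 1 1 * ?g 2 k = s * (- s * perm_symb 1 k)"
    "?g 2 2 * ?g 1 k - ?g 1 2 * ?g 2 k = s * (- s * perm_symb 2 k)"
    using exhaust_2[of k] s(2) by (auto simp: perm_symb_def sym)
  ultimately have
    "?g 1 1 * ?dV 1 + ?g 1 2 * ?dV 2 + (?V 1 * P + ?V 2 * Q) / 2 = - s * perm_symb 1 k"
    "?g 1 2 * ?dV 1 + ?g 2 2 * ?dV 2 + (?V 1 * Q + ?V 2 * R) / 2 = - s * perm_symb 2 k"
    by (simp_all only: mult_left_cancel[OF s(1)])
  then show ?thesis
    using exhaust_2[of n]
    by (auto simp: sum_2 C_cov_def dg sym s_def field_simps)
qed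

text \<open>
  Substituting \<open>E\<close> and \<open>M\<close>, the curvature tensor is \<open>- d\<kappa>\<close> times the Cartan covariant vertical
  derivative of \<open>rot\<close>. Apart from the factor \<open>vol\<close> nothing in it depends on the tangent vector.
\<close>

lemma rho_cov_eq:
  assumes "(x, y) \<in> \<Omega>"
  shows "rho_cov F \<theta> \<kappa> k n i j x y = d\<kappa> i j x * vol x y * perm_symb n k"
proof -
  have gC: "(\<Sum>m\<in>UNIV. g_cov F n m x y * C_mix F m h k x y) = C_cov F n h k x y" for n h
  proof -
    have "(\<Sum>m\<in>UNIV. g_cov F n m x y * C_mix F m h k x y)
      = (g_cov F n 1 x y * g_con F 1 1 x y + g_cov F n 2 x y * g_con F 2 1 x y) * C_cov F 1 h k x y
      + (g_cov F n 1 x y * g_con F 1 2 x y + g_cov F n 2 x y * g_con F 2 2 x y) * C_cov F 2 h k x y"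
      by (simp add: C_mix_def sum_2 algebra_simps)
    then show ?thesis
      using exhaust_2[of n] by (auto simp: g_cov_g_con[OF assms])
  qed
  have dM: "pdy k (curv_M F \<theta> \<kappa> m i j) x y = d\<kappa> i j x * pdy k (rot m) x y" for m
  proof -
    have "pdy k (curv_M F \<theta> \<kappa> m i j) x y = pdy k (\<lambda>x y. d\<kappa> i j x * rot m x y) x y"
      by (rule pdy_cong[OF open_\<Omega> assms]) (rule curv_M_eq)
    also have "\<dots> = d\<kappa> i j x * pdy k (rot m) x y"
      using pd_mult[OF differentiable_const[of "d\<kappa> i j x"]
          smooth_differentiable_y[OF smooth_le[OF rot_smooth] assms, of 0]]
      by (simp add: pdy_def)
    finally show ?thesis .
  qed
  have "rho_cov F \<theta> \<kappa> k n i j x y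
    = - d\<kappa> i j x * ((\<Sum>m\<in>UNIV. g_cov F n m x y * pdy k (rot m) x y)
       + (\<Sum>h\<in>UNIV. rot h x y * (\<Sum>m\<in>UNIV. g_cov F n m x y * C_mix F m h k x y)))"
    by (simp add: rho_cov_def rho_mix_def curv_E_eq[OF assms] dM curv_M_eq[OF assms] sum_2
      algebra_simps)
  then show ?thesis
    unfolding gC rot_vertical_derivative[OF assms] by simp
qed

section \<open>The orthonormal frame of the osculating metric\<close>

text \<open>
  The vectors \<open>e\<close> (the normalised \<open>b\<close>) and \<open>f\<close> (its normal) form an orthonormal frame; the
  primes mark the dual coframe.
\<close>

abbreviation "a \<equiv> a_cov F b"
abbreviation "e k x \<equiv> bt F b x $ k"
abbreviation "e' \<equiv> bt_cov F b"
abbreviation "f \<equiv> n_con F b \<theta>"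
abbreviation "f' \<equiv> n_cov F b \<theta>"
abbreviation "\<Gamma> \<equiv> christoffel F b"
abbreviation "L \<equiv> L_coef F b \<theta> \<kappa>"
abbreviation "vol_b x \<equiv> vol x (b x)"

lemma a_eq: "a i j x = g_cov F i j x (b x)"
  by (simp add: a_cov_def a_mat_def g_cov_def)

lemma a_con_eq: "a_con F b i j x = g_con F i j x (b x)"
  by (simp add: a_con_def a_mat_def g_con_def)

lemma a_C_k: "C_k_on 3 U (a i j)"
  using smooth_section[OF open_U g_smooth b_smooth b_in_\<Omega>] by (simp add: a_eq[abs_def])

lemma vol_b_C_k: "C_k_on 3 U vol_b"
  by (rule smooth_section[OF open_U vol_smooth b_smooth b_in_\<Omega>])

lemma a_symmetric: "x \<in> U \<Longrightarrow> a i j x = a j i x"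
  by (simp add: a_eq g_symmetric b_in_\<Omega>)

lemma pd_a_symmetric: "x \<in> U \<Longrightarrow> pd n (a i j) x = pd n (a j i) x"
  by (rule pd_cong[OF open_U]) (auto intro: a_symmetric)

lemma vol_b_pos: "x \<in> U \<Longrightarrow> vol_b x > 0"
  by (simp add: vol_pos b_in_\<Omega>)

lemma vol_b_square: "x \<in> U \<Longrightarrow> vol_b x * vol_b x = a 1 1 x * a 2 2 x - a 1 2 x * a 2 1 x"
  by (simp add: vol_square b_in_\<Omega> det_g a_eq)

lemma e_eq: "x \<in> U \<Longrightarrow> e k x = b x $ k / F x (b x)"
proof -
  assume x: "x \<in> U"
  note z = b_in_\<Omega>[OF x]
  have "(\<Sum>m\<in>UNIV. \<Sum>n\<in>UNIV. a m n x * b x $ m * b x $ n)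
      = b x $ 1 * y_cov F 1 x (b x) + b x $ 2 * y_cov F 2 x (b x)"
    by (simp add: sum_2 a_eq g_y[OF z, symmetric] algebra_simps)
  then have "sqrt (\<Sum>m\<in>UNIV. \<Sum>n\<in>UNIV. a m n x * b x $ m * b x $ n) = F x (b x)"
    using F_pos[OF z] by (simp add: Y_y[OF z])
  then show ?thesis
    by (simp add: bt_def)
qed

lemma e_C_k: "C_k_on 3 U (e k)"
proof (rule C_k_on_cong[OF open_U])
  have "C_k_on 3 U (\<lambda>x. F x (b x))"
    using smooth_section[OF open_U smooth_le[OF F_smooth] b_smooth b_in_\<Omega>] by simp
  moreover have "F x (b x) \<noteq> 0" if "x \<in> U" for x
    using F_pos[OF b_in_\<Omega>[OF that]] by simp
  ultimately show "C_k_on 3 U (\<lambda>x. b x $ k / F x (b x))"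
    by (intro C_k_on_divide open_U b_smooth)
qed (simp add: e_eq)

lemma e'_eq: "e' i x = a i 1 x * e 1 x + a i 2 x * e 2 x"
  by (simp add: bt_cov_def sum_2)

lemma e'_C_k: "C_k_on 3 U (e' i)"
  unfolding e'_eq[abs_def] by (intro C_k_on_add C_k_on_mult open_U a_C_k e_C_k)

lemma e'_e: "x \<in> U \<Longrightarrow> e' 1 x * e 1 x + e' 2 x * e 2 x = 1"
proof -
  assume x: "x \<in> U"
  note z = b_in_\<Omega>[OF x]
  have "e' 1 x * e 1 x + e' 2 x * e 2 x
      = (b x $ 1 * y_cov F 1 x (b x) + b x $ 2 * y_cov F 2 x (b x)) / (F x (b x))\<^sup>2"
    using F_pos[OF z] by (simp add: e'_eq e_eq x a_eq g_y[OF z, symmetric]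
        g_symmetric[OF z, of 2 1] field_simps power2_eq_square)
  then show ?thesis
    using F_pos[OF z] by (simp add: Y_y[OF z])
qed

text \<open>
  \<open>f'\<close> is defined by derivatives of \<open>\<theta>\<close> at \<open>e\<close>, whereas \<open>a\<close> is the metric at \<open>b\<close>. The two base
  points lie on one ray, and the \<open>y\<close>-derivatives of \<open>\<theta>\<close> are homogeneous of degree -1.
\<close>

lemma f'_eq:
  assumes x: "x \<in> U"
  shows "f' 1 x = - vol_b x * e 2 x" "f' 2 x = vol_b x * e 1 x"
proof -
  note z = b_in_\<Omega>[OF x]
  let ?t = "1 / F x (b x)"
  have t: "?t > 0" using F_pos[OF z] by simp
  have bt: "bt F b x = ?t *\<^sub>R b x"
    by (simp add: vec_eq_iff e_eq[OF x])
  have cone: "(x, t *\<^sub>R y) \<in> \<Omega>" "\<theta> x (t *\<^sub>R y) = \<theta> x y" if "(x, y) \<in> \<Omega>" "t > 0" for y t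
    using that conic angle by (auto simp: conic_region_def angle_function_def)
  have diff: "\<theta> x differentiable (at (?t *\<^sub>R b x))"
    using smooth_differentiable_y[OF _ cone(1)[OF z t], of 2 \<theta>] \<theta>_smooth by simp
  have scale: "?t * pdy i \<theta> x (bt F b x) = pdy i \<theta> x (b x)" for i
  proof -
    have "((\<lambda>y. ?t *\<^sub>R y) has_derivative (\<lambda>v. ?t *\<^sub>R v)) (at (b x))"
      by (auto intro!: derivative_eq_intros)
    from has_derivative_compose[OF this has_derivative_dir_deriv[OF diff]]
    have "dir_deriv (axis i 1) (\<lambda>y. \<theta> x (?t *\<^sub>R y)) (b x)
      = dir_deriv (?t *\<^sub>R axis i 1) (\<theta> x) (?t *\<^sub>R b x)"
      by (rule dir_deriv_eqI)
    also have "\<dots> = ?t * dir_deriv (axis i 1) (\<theta> x) (?t *\<^sub>R b x)"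
      using linear_frechet_derivative[OF diff] by (simp add: dir_deriv_def linear_cmul)
    finally have "pdy i (\<lambda>x y. \<theta> x (?t *\<^sub>R y)) x (b x) = ?t * pdy i \<theta> x (bt F b x)"
      by (simp add: pdy_def pd_eq_dir_deriv bt)
    moreover have "pdy i (\<lambda>x y. \<theta> x (?t *\<^sub>R y)) x (b x) = pdy i \<theta> x (b x)"
      unfolding pdy_def
    proof (rule pd_cong)
      show "open ((\<lambda>y. (x, y)) -` \<Omega>)"
        by (intro open_vimage open_\<Omega> continuous_intros)
    qed (use z cone(2) t in auto)
    ultimately show ?thesis by simp
  qed
  have "f' i x = m_cov F i x (b x)" for i
    using scale[of i] F_pos[OF z] by (simp add: n_cov_def \<theta>_y[OF z])
  then show "f' 1 x = - vol_b x * e 2 x" "f' 2 x = vol_b x * e 1 x"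
    by (simp_all add: m_cov_eq e_eq[OF x])
qed

lemma f_eq:
  assumes x: "x \<in> U"
  shows "f 1 x = - e' 2 x / vol_b x" "f 2 x = e' 1 x / vol_b x"
  using vol_b_pos[OF x]
  by (simp_all add: n_con_def sum_2 f'_eq[OF x] e'_eq a_eq a_con_eq g_con_eq[OF b_in_\<Omega>[OF x]]
      g_symmetric[OF b_in_\<Omega>[OF x], of 2 1] field_simps)

lemma f_C_k: "C_k_on 3 U (f k)"
proof -
  have "C_k_on 3 U (f 1)"
    by (rule C_k_on_cong[OF open_U _ C_k_on_divide[OF open_U C_k_on_minus[OF open_U e'_C_k]
      vol_b_C_k]])
      (use vol_b_pos in \<open>auto simp: f_eq less_imp_neq[THEN not_sym]\<close>)
  moreover have "C_k_on 3 U (f 2)"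
    by (rule C_k_on_cong[OF open_U _ C_k_on_divide[OF open_U e'_C_k vol_b_C_k]])
      (use vol_b_pos in \<open>auto simp: f_eq less_imp_neq[THEN not_sym]\<close>)
  ultimately show ?thesis
    using exhaust_2[of k] by auto
qed

lemma f'_C_k: "C_k_on 3 U (f' i)"
proof -
  have "C_k_on 3 U (f' 1)"
    by (rule C_k_on_cong[OF open_U _ C_k_on_mult[OF open_U C_k_on_minus[OF open_U vol_b_C_k]
      e_C_k]])
      (use vol_b_pos in \<open>auto simp: f'_eq\<close>)
  moreover have "C_k_on 3 U (f' 2)"
    by (rule C_k_on_cong[OF open_U _ C_k_on_mult[OF open_U vol_b_C_k e_C_k]])
      (use vol_b_pos in \<open>auto simp: f'_eq\<close>)
  ultimately show ?thesis
    using exhaust_2[of i] by auto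
qed

lemma dual_frame:
  assumes x: "x \<in> U"
  shows "f' 1 x * f 1 x + f' 2 x * f 2 x = 1"
    "e' 1 x * f 1 x + e' 2 x * f 2 x = 0"
  using vol_b_pos[OF x] e'_e[OF x] by (simp_all add: f_eq[OF x] f'_eq[OF x] field_simps)

lemma frame_complete:
  assumes x: "x \<in> U"
  shows "e k x * e' h x + f k x * f' h x = (if k = h then 1 else 0)"
  using exhaust_2[of k] exhaust_2[of h] vol_b_pos[OF x] e'_e[OF x]
  by (auto simp: f_eq[OF x] f'_eq[OF x] field_simps)

lemma f'_lower:
  assumes x: "x \<in> U"
  shows "a i 1 x * f 1 x + a i 2 x * f 2 x = f' i x"
proof -
  have "vol_b x * (a i 1 x * f 1 x + a i 2 x * f 2 x) = a i 2 x * e' 1 x - a i 1 x * e' 2 x"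
    using vol_b_pos[OF x] by (simp add: f_eq[OF x] field_simps)
  also have "\<dots> = vol_b x * f' i x"
  proof -
    have "a 1 2 x * e' 1 x - a 1 1 x * e' 2 x = vol_b x * f' 1 x"
      "a 2 2 x * e' 1 x - a 2 1 x * e' 2 x = vol_b x * f' 2 x"
      using vol_b_square[OF x] a_symmetric[OF x, of 2 1] unfolding e'_eq f'_eq[OF x] by algebra+
    then show ?thesis
      using exhaust_2[of i] by auto
  qed
  finally show ?thesis
    using vol_b_pos[OF x] by simp
qed

lemma a_con_a_cov:
  assumes x: "x \<in> U"
  shows "a i 1 x * a_con F b 1 j x + a i 2 x * a_con F b 2 j x = (if i = j then 1 else 0)"
  using g_cov_g_con[OF b_in_\<Omega>[OF x]] by (simp add: a_eq a_con_eq)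

section \<open>The associated Riemannian connection and its curvature\<close>

lemma christoffel_lower:
  assumes x: "x \<in> U"
  shows "a l 1 x * \<Gamma> 1 n h x + a l 2 x * \<Gamma> 2 n h x
    = (pd n (a l h) x + pd h (a l n) x - pd l (a n h) x) / 2"
proof -
  let ?c = "\<lambda>j. pd n (a j h) x + pd h (a j n) x - pd j (a n h) x"
  have "a l 1 x * \<Gamma> 1 n h x + a l 2 x * \<Gamma> 2 n h x
    = ((a l 1 x * a_con F b 1 1 x + a l 2 x * a_con F b 2 1 x) * ?c 1
      + (a l 1 x * a_con F b 1 2 x + a l 2 x * a_con F b 2 2 x) * ?c 2) / 2"
    by (simp add: christoffel_def sum_2 field_simps)
  then show ?thesis
    using exhaust_2[of l] by (auto simp: a_con_a_cov[OF x])
qed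

lemma christoffel_metric:
  assumes x: "x \<in> U"
  shows "a j 1 x * \<Gamma> 1 n h x + a j 2 x * \<Gamma> 2 n h x + (a h 1 x * \<Gamma> 1 n j x + a h 2 x * \<Gamma> 2 n j x)
    = pd n (a j h) x"
  unfolding christoffel_lower[OF x]
  by (simp add: pd_a_symmetric[OF x, of _ h j] pd_a_symmetric[OF x, of _ n h] pd_a_symmetric[OF x,
    of _ n j] field_simps)

lemma L_eq:
  assumes x: "x \<in> U"
  shows "L k n 1 x = a_con F b k 2 x * (- vol_b x) * T_cov F b \<theta> \<kappa> n x + \<Gamma> k n 1 x"
   "L k n 2 x = a_con F b k 1 x * vol_b x * T_cov F b \<theta> \<kappa> n x + \<Gamma> k n 2 x"
  by (simp_all add: L_coef_def sum_2 eps_riem_def perm_symb_def vol_def a_mat_def)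

text \<open>
  \<open>L\<close> arises from the Christoffel symbols by adding a multiple of the antisymmetric area form,
  which does not affect metricity.
\<close>

lemma L_metric:
  assumes x: "x \<in> U"
  shows "a j 1 x * L 1 n h x + a j 2 x * L 2 n h x + (a h 1 x * L 1 n j x + a h 2 x * L 2 n j x)
    = pd n (a j h) x"
proof -
  let ?T = "T_cov F b \<theta> \<kappa> n x"
  have "a j 1 x * L 1 n h x + a j 2 x * L 2 n h x
      = a j 1 x * \<Gamma> 1 n h x + a j 2 x * \<Gamma> 2 n h x + vol_b x * perm_symb j h * ?T" for j h
  proof -
    have *: "a j 1 x * L 1 n 1 x + a j 2 x * L 2 n 1 x = a j 1 x * \<Gamma> 1 n 1 x + a j 2 x * \<Gamma> 2 n 1 x
        - vol_b x * ?T * (a j 1 x * a_con F b 1 2 x + a j 2 x * a_con F b 2 2 x)"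
      "a j 1 x * L 1 n 2 x + a j 2 x * L 2 n 2 x = a j 1 x * \<Gamma> 1 n 2 x + a j 2 x * \<Gamma> 2 n 2 x
        + vol_b x * ?T * (a j 1 x * a_con F b 1 1 x + a j 2 x * a_con F b 2 1 x)"
      by (simp_all add: L_eq[OF x] algebra_simps)
    show ?thesis
      using exhaust_2[of j] exhaust_2[of h] * by (auto simp: a_con_a_cov[OF x] perm_symb_def)
  qed
  then show ?thesis
    using exhaust_2[of j] exhaust_2[of h] christoffel_metric[OF x, of j n h] by
      (auto simp: perm_symb_def)
qed

text \<open>
  Product rule for the inner product of two vector fields with respect to any connection, with
  coefficients \<open>\<Lambda>\<close> in the direction \<open>n\<close>, that preserves the metric. It serves both for the
  Christoffel symbols and for \<open>L\<close>.
\<close>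

lemma metric_derivative:
  fixes \<Lambda> :: "2 \<Rightarrow> 2 \<Rightarrow> real"
  assumes x: "x \<in> U"
    and metric: "\<And>j h. a j 1 x * \<Lambda> 1 h + a j 2 x * \<Lambda> 2 h + (a h 1 x * \<Lambda> 1 j + a h 2 x * \<Lambda> 2 j)
      = pd n (a j h) x"
    and u: "\<And>k. u k differentiable (at x)" and w: "\<And>k. w k differentiable (at x)"
  shows "pd n (\<lambda>x. (a 1 1 x * u 1 x + a 1 2 x * u 2 x) * w 1 x + (a 2 1 x * u 1 x
    + a 2 2 x * u 2 x) * w 2 x) x
    = (a 1 1 x * u 1 x + a 1 2 x * u 2 x) * (pd n (w 1) x + (\<Lambda> 1 1 * w 1 x + \<Lambda> 1 2 * w 2 x))
    + (a 2 1 x * u 1 x + a 2 2 x * u 2 x) * (pd n (w 2) x + (\<Lambda> 2 1 * w 1 x + \<Lambda> 2 2 * w 2 x))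
    + (a 1 1 x * w 1 x + a 1 2 x * w 2 x) * (pd n (u 1) x + (\<Lambda> 1 1 * u 1 x + \<Lambda> 1 2 * u 2 x))
    + (a 2 1 x * w 1 x + a 2 2 x * w 2 x) * (pd n (u 2) x + (\<Lambda> 2 1 * u 1 x + \<Lambda> 2 2 * u 2 x))"
proof -
  have a: "a i j differentiable (at x)" for i j
    using C_k_on_differentiable[of 2, OF _ x] a_C_k[of i j] by simp
  show ?thesis
    by (simp add: pd_add pd_mult a u w metric[symmetric])
      (simp add: a_symmetric[OF x, of 2 1] algebra_simps)
qed

lemma frame_differentiable:
  assumes x: "x \<in> U"
  shows "e k differentiable (at x)" "f k differentiable (at x)" "a i j differentiable (at x)"
  using C_k_on_differentiable[of 2, OF _ x] a_C_k[of i j] e_C_k[of k] f_C_k[of k] by simp_all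

lemma nabla_e':
  assumes x: "x \<in> U"
  shows "nabla_cov F b n e' h x = a h 1 x * (pd n (e 1) x + (\<Gamma> 1 n 1 x * e 1 x + \<Gamma> 1 n 2 x * e 2 x))
    + a h 2 x * (pd n (e 2) x + (\<Gamma> 2 n 1 x * e 1 x + \<Gamma> 2 n 2 x * e 2 x))"
proof -
  have "pd n (e' h) x = pd n (a h 1) x * e 1 x + a h 1 x * pd n (e 1) x
      + (pd n (a h 2) x * e 2 x + a h 2 x * pd n (e 2) x)"
    unfolding e'_eq[abs_def] by (simp add: pd_add pd_mult frame_differentiable[OF x])
  then show ?thesis
    by (simp add: nabla_cov_def sum_2 christoffel_metric[OF x, symmetric] e'_eq)
      (simp add: a_symmetric[OF x, of 2 1] algebra_simps)
qed

text \<open>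
  In the frame \<open>(e, f)\<close> the connection form of \<open>L\<close> is \<open>- \<kappa>\<close>. The Riemannian derivative of \<open>e\<close> is
  \<open>(T\<^sub>n - \<kappa>\<^sub>n) f\<close>, as \<open>e\<close> has constant length; the area form turns \<open>e\<close> into \<open>- f\<close>, so the
  additional term of \<open>L\<close> contributes \<open>- T\<^sub>n f\<close> and only \<open>- \<kappa>\<^sub>n f\<close> remains. Metricity then fixes
  the derivative of \<open>f\<close>.
\<close>

lemma frame_equations:
  assumes x: "x \<in> U"
  shows "pd n (e k) x + (L k n 1 x * e 1 x + L k n 2 x * e 2 x) = - \<kappa> x $ n * f k x"
    and "pd n (f k) x + (L k n 1 x * f 1 x + L k n 2 x * f 2 x) = \<kappa> x $ n * e k x"
proof -
  have diff: "e k differentiable (at x)" "f k differentiable (at x)" for k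
    by (rule frame_differentiable[OF x])+
  define De where "De = (\<lambda>k. pd n (e k) x + (\<Gamma> k n 1 x * e 1 x + \<Gamma> k n 2 x * e 2 x))"
  define Lf where "Lf = (\<lambda>k. pd n (f k) x + (L k n 1 x * f 1 x + L k n 2 x * f 2 x))"
  define Le where "Le = (\<lambda>k. pd n (e k) x + (L k n 1 x * e 1 x + L k n 2 x * e 2 x))"
  have const: "pd n p x = 0" if "\<And>x. x \<in> U \<Longrightarrow> p x = c" for p c
    using pd_cong[OF open_U x, of p "\<lambda>_. c"] that by simp
  have expand: "u k = e k x * (e' 1 x * u 1 + e' 2 x * u 2) + f k x * (f' 1 x * u 1 + f' 2 x * u 2)"
    for u :: "2 \<Rightarrow> real" and k
  proof -
    have "e k x * (e' 1 x * u 1 + e' 2 x * u 2) + f k x * (f' 1 x * u 1 + f' 2 x * u 2)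
      = (e k x * e' 1 x + f k x * f' 1 x) * u 1 + (e k x * e' 2 x + f k x * f' 2 x) * u 2"
      by (simp add: algebra_simps)
    then show ?thesis
      using exhaust_2[of k] by (auto simp: frame_complete[OF x])
  qed
  have eDe: "e' 1 x * De 1 + e' 2 x * De 2 = 0"
    using metric_derivative[where n = n and u = e and w = e and \<Lambda> = "\<lambda>k h. \<Gamma> k n h x",
      OF x christoffel_metric[OF x] diff(1) diff(1)]
      const[of "\<lambda>x. e' 1 x * e 1 x + e' 2 x * e 2 x" 1] e'_e
    by (simp add: e'_eq[symmetric] De_def)
  have T: "T_cov F b \<theta> \<kappa> n x = f' 1 x * De 1 + f' 2 x * De 2 + \<kappa> x $ n"
  proof -
    have "nabla_cov F b n e' h x = a h 1 x * De 1 + a h 2 x * De 2" for h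
      by (simp add: nabla_e'[OF x] De_def)
    then show ?thesis
      by (simp add: T_cov_def sum_2 f'_lower[OF x, symmetric] a_symmetric[OF x, of 2 1]
        algebra_simps)
  qed
  have f_con: "f k x = a_con F b k 1 x * f' 1 x + a_con F b k 2 x * f' 2 x" for k
    by (simp add: n_con_def sum_2)
  have Le_De: "Le k = De k - f k x * T_cov F b \<theta> \<kappa> n x" for k
    by (simp add: Le_def De_def L_eq[OF x] f_con f'_eq[OF x] algebra_simps)
  have Le: "Le k = - \<kappa> x $ n * f k x" for k
    unfolding Le_De T using expand[of De k, unfolded eDe] by (simp add: algebra_simps)
  then show "pd n (e k) x + (L k n 1 x * e 1 x + L k n 2 x * e 2 x) = - \<kappa> x $ n * f k x"
    by (simp add: Le_def)
  have "e' 1 x * Lf 1 + e' 2 x * Lf 2 - f' 1 x * (\<kappa> x $ n * f 1 x) = f' 2 x * (\<kappa> x $ n * f 2 x)"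
    using metric_derivative[where n = n and u = e and w = f and \<Lambda> = "\<lambda>k h. L k n h x",
      OF x L_metric[OF x] diff(1) diff(2)]
      const[of "\<lambda>x. e' 1 x * f 1 x + e' 2 x * f 2 x" 0] dual_frame(2)
    by (simp add: e'_eq[symmetric] Lf_def f'_lower[OF x] Le[unfolded Le_def])
  then have eLf: "e' 1 x * Lf 1 + e' 2 x * Lf 2 = \<kappa> x $ n"
    using dual_frame(1)[OF x] by algebra
  have fLf: "f' 1 x * Lf 1 + f' 2 x * Lf 2 = 0"
    using metric_derivative[where n = n and u = f and w = f and \<Lambda> = "\<lambda>k h. L k n h x",
      OF x L_metric[OF x] diff(2) diff(2)]
      const[of "\<lambda>x. (a 1 1 x * f 1 x + a 1 2 x * f 2 x) * f 1 x + (a 2 1 x * f 1 x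
        + a 2 2 x * f 2 x) * f 2 x"]
      dual_frame(1)
    by (simp add: Lf_def f'_lower[OF x] f'_lower)
  show "pd n (f k) x + (L k n 1 x * f 1 x + L k n 2 x * f 2 x) = \<kappa> x $ n * e k x"
    using expand[of Lf k, unfolded eLf fLf] by (simp add: Lf_def)
qed

text \<open>
  The frame equations can be solved for the coefficients of \<open>L\<close>, which yields their
  differentiability without a look at the Christoffel symbols.
\<close>

lemma L_from_frame:
  assumes x: "x \<in> U"
  shows "L k n h x = (- \<kappa> x $ n * f k x - pd n (e k) x) * e' h x
    + (\<kappa> x $ n * e k x - pd n (f k) x) * f' h x"
proof -
  have "L k n h x = L k n 1 x * (e 1 x * e' h x + f 1 x * f' h x) + L k n 2 x * (e 2 x * e' h x
    + f 2 x * f' h x)"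
    using exhaust_2[of h] by (auto simp: frame_complete[OF x])
  also have "\<dots> = (L k n 1 x * e 1 x + L k n 2 x * e 2 x) * e' h x + (L k n 1 x * f 1 x
    + L k n 2 x * f 2 x) * f' h x"
    by (simp add: algebra_simps)
  finally show ?thesis
    using frame_equations[OF x, where k = k and n = n] by algebra
qed

lemma L_C_k: "C_k_on 1 U (L k n h)"
proof (rule C_k_on_cong[OF open_U])
  have "C_k_on 1 U (pd n (e k))" "C_k_on 1 U (pd n (f k))"
    using C_k_on_pd[of 1 U] C_k_on_le[OF e_C_k, of 2 k] C_k_on_le[OF f_C_k, of 2 k]
    by (simp_all add: numeral_2_eq_2)
  then show "C_k_on 1 U (\<lambda>x. (- \<kappa> x $ n * f k x - pd n (e k) x) * e' h x
      + (\<kappa> x $ n * e k x - pd n (f k) x) * f' h x)"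
    by (intro C_k_on_add C_k_on_diff C_k_on_mult C_k_on_minus open_U C_k_on_le[OF e_C_k]
      C_k_on_le[OF f_C_k]
       C_k_on_le[OF e'_C_k] C_k_on_le[OF f'_C_k] C_k_on_le[OF \<kappa>_smooth]) simp_all
qed (simp add: L_from_frame)

text \<open>
  A connection that rotates the pair \<open>(u, w)\<close> at the rate \<open>c\<close> has a curvature that sends \<open>u\<close> to
  \<open>dc \<cdot> w\<close>: differentiate the first equation and antisymmetrise. The terms quadratic in \<open>c\<close> drop
  out since plane rotations commute. The statement is general in \<open>(u, w, c)\<close> so that it applies
  to \<open>(e, f, - \<kappa>)\<close> and to \<open>(f, e, \<kappa>)\<close>.
\<close>

lemma L_curvature_frame:
  fixes u w :: "2 \<Rightarrow> real^2 \<Rightarrow> real" and c :: "2 \<Rightarrow> real^2 \<Rightarrow> real"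
  assumes x: "x \<in> U"
    and u: "\<And>k. C_k_on 2 U (u k)" and w: "\<And>k. C_k_on 2 U (w k)" and c: "\<And>n. C_k_on 2 U (c n)"
    and eqs: "\<And>x n k. x \<in> U \<Longrightarrow> pd n (u k) x + (L k n 1 x * u 1 x + L k n 2 x * u 2 x)
      = c n x * w k x"
      "\<And>x n k. x \<in> U \<Longrightarrow> pd n (w k) x + (L k n 1 x * w 1 x + L k n 2 x * w 2 x) = - c n x * u k x"
  shows "curv_L_mix F b \<theta> \<kappa> 1 n i j x * u 1 x + curv_L_mix F b \<theta> \<kappa> 2 n i j x * u 2 x
    = (pd i (c j) x - pd j (c i) x) * w n x"
proof -
  have diff: "u k differentiable (at x)" "w k differentiable (at x)" "c k differentiable (at x)"
    "pd n (u k) differentiable (at x)" "L k n h differentiable (at x)" for k n h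
    using C_k_on_differentiable[OF _ x] C_k_on_pd[of 1 U "u k"] u[of k] w[of k] c[of k] L_C_k[of k
      n h]
    by (auto simp: numeral_2_eq_2)
  have du: "pd n (u k) y = c n y * w k y - (L k n 1 y * u 1 y + L k n 2 y * u 2 y)" if "y \<in> U"
    for n k y
    using eqs(1)[OF that, of n k] by simp
  have dw: "pd n (w k) x = - c n x * u k x - (L k n 1 x * w 1 x + L k n 2 x * w 2 x)" for n k
    using eqs(2)[OF x, of n k] by simp
  have ddu: "pd i (pd j (u n)) x + (pd i (L n j 1) x * u 1 x + L n j 1 x * pd i (u 1) x
      + (pd i (L n j 2) x * u 2 x + L n j 2 x * pd i (u 2) x))
    = pd i (c j) x * w n x + c j x * pd i (w n) x" for i j
  proof -
    have "pd i (\<lambda>x. pd j (u n) x + (L n j 1 x * u 1 x + L n j 2 x * u 2 x)) x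
      = pd i (\<lambda>x. c j x * w n x) x"
      by (rule pd_cong[OF open_U x]) (rule eqs(1))
    then show ?thesis
      by (simp add: pd_add pd_mult diff algebra_simps)
  qed
  have "pd i (pd j (u n)) x = pd j (pd i (u n)) x"
    by (rule pd_commute[OF open_U u x])
  with ddu[of i j] ddu[of j i] show ?thesis
    unfolding curv_L_mix_def sum_2 dw du[OF x] by algebra
qed

text \<open>
  The curvature turns \<open>e\<close> into \<open>- d\<kappa> f\<close> and \<open>f\<close> into \<open>d\<kappa> e\<close>; with the index lowered it is \<open>d\<kappa>\<close>
  times the area form of \<open>a\<close>. The Gauss curvature of \<open>a\<close> has disappeared because \<open>T\<close> contains
  the rotation coefficients of the frame.
\<close>

lemma curv_L_cov_eq:
  assumes x: "x \<in> U"
  shows "curv_L_cov F b \<theta> \<kappa> k n i j x = d\<kappa> i j x * vol_b x * perm_symb n k"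
proof -
  let ?R = "\<lambda>k n. curv_L_mix F b \<theta> \<kappa> k n i j x"
  have e2: "C_k_on 2 U (e k)" and f2: "C_k_on 2 U (f k)" for k
    by (rule C_k_on_le[OF e_C_k] C_k_on_le[OF f_C_k]; simp)+
  have dk: "pd i (\<lambda>x. - \<kappa> x $ j) x = - pd i (\<lambda>x. \<kappa> x $ j) x" for i j
    using C_k_on_differentiable[OF _ x] \<kappa>_smooth[of j] by (intro pd_minus)
      (auto simp: numeral_2_eq_2)
  have Re: "?R 1 n * e 1 x + ?R 2 n * e 2 x = - d\<kappa> i j x * f n x" for n
    using L_curvature_frame[OF x e2 f2 C_k_on_minus[OF open_U \<kappa>_smooth] frame_equations(1), of n i
      j]
      frame_equations(2) by (simp add: dk d\<kappa>_def)
  have Rf: "?R 1 n * f 1 x + ?R 2 n * f 2 x = d\<kappa> i j x * e n x" for n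
    using L_curvature_frame[OF x f2 e2 \<kappa>_smooth frame_equations(2), of n i j]
      frame_equations(1) by (simp add: d\<kappa>_def)
  have R: "?R k n = d\<kappa> i j x * (e n x * f' k x - f n x * e' k x)" for k n
  proof -
    have "?R k n = ?R 1 n * (e 1 x * e' k x + f 1 x * f' k x) + ?R 2 n * (e 2 x * e' k x
      + f 2 x * f' k x)"
      using exhaust_2[of k] by (auto simp: frame_complete[OF x])
    also have "\<dots> = (?R 1 n * e 1 x + ?R 2 n * e 2 x) * e' k x + (?R 1 n * f 1 x
      + ?R 2 n * f 2 x) * f' k x"
      by (simp add: algebra_simps)
    finally show ?thesis
      unfolding Re Rf by (simp add: algebra_simps)
  qed
  have "curv_L_cov F b \<theta> \<kappa> k n i j x = d\<kappa> i j x * (e' n x * f' k x - f' n x * e' k x)"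
    by (simp add: curv_L_cov_def sum_2 R e'_eq f'_lower[OF x, symmetric] algebra_simps)
  also have "e' n x * f' k x - f' n x * e' k x = vol_b x * perm_symb n k"
  proof -
    have "e' 1 x * f' 2 x - f' 1 x * e' 2 x = vol_b x"
      using e'_e[OF x] unfolding f'_eq[OF x] by algebra
    then show ?thesis
      using exhaust_2[of n] exhaust_2[of k] by (auto simp: perm_symb_def algebra_simps)
  qed
  finally show ?thesis by simp
qed

end

section \<open>Proportionality of the curvature tensors\<close>

theorem theorem4p1:
  fixes U :: "(real^2) set"
    and \<Omega> :: "((real^2) \<times> (real^2)) set"
    and F \<theta> :: "real^2 \<Rightarrow> real^2 \<Rightarrow> real"
    and b \<kappa> :: "real^2 \<Rightarrow> real^2"
  assumes "open U"
    and "finsler_metric U F"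
    and "\<And>i. C_k_on 3 U (\<lambda>x. b x $ i)"
    and "\<And>x. x \<in> U \<Longrightarrow> b x \<noteq> 0"
    and "conic_region U b \<Omega>"
    and "angle_function U \<Omega> F b \<theta>"
    and "\<And>n. C_k_on 2 U (\<lambda>x. \<kappa> x $ n)"
  shows "\<forall>(x, y)\<in>\<Omega>. \<forall>k n i j.
    rho_cov F \<theta> \<kappa> k n i j x y =
      sqrt (det (g_mat F x y) / det (a_mat F b x)) * curv_L_cov F b \<theta> \<kappa> k n i j x"
proof -
  interpret finsler_angle_space U \<Omega> F \<theta> b \<kappa>
    by unfold_locales (fact assms)+
  have "rho_cov F \<theta> \<kappa> k n i j x y =
      sqrt (det (g_mat F x y) / det (a_mat F b x)) * curv_L_cov F b \<theta> \<kappa> k n i j x"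
    if "(x, y) \<in> \<Omega>" for x y k n i j
  proof -
    have "sqrt (det (g_mat F x y) / det (a_mat F b x)) = vol x y / vol_b x"
      by (simp add: real_sqrt_divide vol_def a_mat_def)
    then show ?thesis
      using vol_b_pos[OF \<Omega>D(1)[OF that]]
      by (simp add: rho_cov_eq[OF that] curv_L_cov_eq[OF \<Omega>D(1)[OF that]])
  qed
  then show ?thesis by blast
qed

end
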